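(* Let $\Omega\subset\mathbb{R}^2$ be a smooth, convex, bounded, open set and let $\mathcal{N}_t$, $t\in[0,T)$, be the curvature flow of a regular network in $\overline\Omega$ with fixed end-points on the boundary of $\Omega$. Then, for every time $t\in[0,T)$, the network $\mathcal{N}_t$ intersects the boundary of $\Omega$ only at the end-points, and such intersections are transversal for every positive time. Moreover, $\mathcal{N}_t$ remains embedded.
   Context: A $C^1$ curve $\gamma:[0,1]\to\mathbb{R}^2$ is regular if $\gamma_x\neq 0$ everywhere; $\tau=\gamma_x/|\gamma_x|$ is its unit tangent, $\nu$ is $\tau$ rotated anticlockwise by $\pi/2$, $\partial_s=|\gamma_x|^{-1}\partial_x$, and the curvature vector is $\boldsymbol{k}=\tau_s=k\nu$. A network in $\overline\Omega$ is a connected set described by a finite family of regular $C^1$ curves contained in $\overline\Omega$ such that: (1) the interior of every curve is injective, and a curve can self-intersect only at its end-points; (2) two different curves can intersect each other only at their end-points; (3) a curve is allowed to meet $\partial\Omega$ only at its end-points; (4) if an end-point of a curve coincides with $P\in\partial\Omega$, then no other end-point of any curve coincides with $P$. The curves meet at multi-points $O^1,\dots,O^m\in\Omega$; the vertices of order one $P^1,\dots,P^l\in\partial\Omega$ are called the end-points of the network. "Embedded" means that properties (1) and (2) hold. A network is regular if all its multi-points are triple (three concurring curve ends) and at each of them the sum of the unit tangent vectors of the three concurring curves (all oriented outward from the multi-point) is zero. A curvature flow of a regular network $\mathcal{N}_0$ with fixed end-points, on $[0,T)$, is a family $\mathcal{N}_t=\bigcup_{i=1}^n\gamma^i(t,[0,1])$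 starting at $\mathcal{N}_0$, with $\gamma^i\in C^{\frac{2+\alpha}{2},2+\alpha}([0,T)\times[0,1];\mathbb{R}^2)$ (parabolic Hölder space, $\alpha\in(0,1)$), each $\gamma^i(t,\cdot)$ regular, such that for all $t,x,i$: $(\gamma^i_t)^\perp=\boldsymbol{k}^i$ (where $^\perp$ is the normal component); the curves that concur at a triple point of $\mathcal{N}_0$ (same combinatorial structure) remain concurrent; at each triple point the sum of the three outward unit tangents is zero; and the end-points $P^r\in\partial\Omega$ stay fixed in time. *)

theory Defs
  imports "HOL-Analysis.Analysis"
begin

type_synonym plane = "real ^ 2"

definition rot90 :: "plane \<Rightarrow> plane" where
  "rot90 v = vector [- (v $ 2), v $ 1]"


subsection \<open>Domains with smooth boundary\<close>

definition smooth_function :: "(real \<Rightarrow> real) \<Rightarrow> bool" where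
  "smooth_function g \<longleftrightarrow> (\<forall>k. ((deriv ^^ k) g) differentiable_on UNIV)"

text \<open>Near each boundary point the set is, in suitable orthonormal coordinates, the strict
  epigraph of a smooth function.\<close>

definition smooth_boundary :: "plane set \<Rightarrow> bool" where
  "smooth_boundary \<Omega> \<longleftrightarrow>
     (\<forall>p\<in>frontier \<Omega>. \<exists>r>0. \<exists>e g. norm e = 1 \<and> smooth_function g \<and>
        (\<forall>q\<in>ball p r. q \<in> \<Omega> \<longleftrightarrow> g (q \<bullet> e) < q \<bullet> rot90 e))"

text \<open>Velocities at \<open>p\<close> of curves in \<open>S\<close>; when \<open>S\<close> is a smooth boundary curve this is its
  tangent line at \<open>p\<close>, translated to the origin.\<close>

definition tangent_space :: "plane set \<Rightarrow> plane \<Rightarrow> plane set" where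
  "tangent_space S p = {v. \<exists>c. c 0 = p \<and> (\<forall>\<^sub>F s in nhds 0. c s \<in> S) \<and>
                              (c has_vector_derivative v) (at (0::real))}"


subsection \<open>Curves parametrized on the unit interval\<close>

text \<open>All derivatives with respect to the parameter are taken within the closed unit interval,
  so they are one-sided at the two end-points.\<close>

definition dx :: "(real \<Rightarrow> plane) \<Rightarrow> real \<Rightarrow> plane" where
  "dx c x = vector_derivative c (at x within {0..1})"

definition regular_C1_curve :: "(real \<Rightarrow> plane) \<Rightarrow> bool" where
  "regular_C1_curve c \<longleftrightarrow>
     c differentiable_on {0..1} \<and> continuous_on {0..1} (dx c) \<and> (\<forall>x\<in>{0..1}. dx c x \<noteq> 0)"

definition unit_tangent :: "(real \<Rightarrow> plane) \<Rightarrow> real \<Rightarrow> plane" where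
  "unit_tangent c x = dx c x /\<^sub>R norm (dx c x)"

definition unit_normal :: "(real \<Rightarrow> plane) \<Rightarrow> real \<Rightarrow> plane" where
  "unit_normal c x = rot90 (unit_tangent c x)"

definition curvature_vector :: "(real \<Rightarrow> plane) \<Rightarrow> real \<Rightarrow> plane" where
  "curvature_vector c x = dx (unit_tangent c) x /\<^sub>R norm (dx c x)"

definition normal_component :: "(real \<Rightarrow> plane) \<Rightarrow> real \<Rightarrow> plane \<Rightarrow> plane" where
  "normal_component c x v = (v \<bullet> unit_normal c x) *\<^sub>R unit_normal c x"

definition transversal_at :: "(real \<Rightarrow> plane) \<Rightarrow> real \<Rightarrow> plane set \<Rightarrow> bool" where
  "transversal_at c x S \<longleftrightarrow> span (insert (dx c x) (tangent_space S (c x))) = UNIV"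


subsection \<open>Networks\<close>

text \<open>A family of \<open>n\<close> curves is a function \<open>\<sigma>\<close> of which only the values \<open>\<sigma> i x\<close> with
  \<open>i < n\<close> and \<open>x \<in> {0..1}\<close> matter. A curve end is a pair \<open>(i, x)\<close> with \<open>x \<in> {0, 1}\<close>, so a
  curve closing up at a vertex contributes two ends there.\<close>

definition network_set :: "nat \<Rightarrow> (nat \<Rightarrow> real \<Rightarrow> plane) \<Rightarrow> plane set" where
  "network_set n \<sigma> = (\<Union>i<n. \<sigma> i ` {0..1})"

definition curve_ends :: "nat \<Rightarrow> (nat \<times> real) set" where
  "curve_ends n = {..<n} \<times> {0, 1}"

definition ends_at :: "nat \<Rightarrow> (nat \<Rightarrow> real \<Rightarrow> plane) \<Rightarrow> plane \<Rightarrow> (nat \<times> real) set" where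
  "ends_at n \<sigma> p = {(i, x) \<in> curve_ends n. \<sigma> i x = p}"

definition multi_points :: "nat \<Rightarrow> (nat \<Rightarrow> real \<Rightarrow> plane) \<Rightarrow> plane set" where
  "multi_points n \<sigma> = {p. card (ends_at n \<sigma> p) \<ge> 2}"

definition end_points :: "nat \<Rightarrow> (nat \<Rightarrow> real \<Rightarrow> plane) \<Rightarrow> plane set" where
  "end_points n \<sigma> = {p. card (ends_at n \<sigma> p) = 1}"

definition embedded :: "nat \<Rightarrow> (nat \<Rightarrow> real \<Rightarrow> plane) \<Rightarrow> bool" where
  "embedded n \<sigma> \<longleftrightarrow>
     (\<forall>i<n. \<forall>x\<in>{0..1}. \<forall>y\<in>{0..1}. \<sigma> i x = \<sigma> i y \<and> x \<noteq> y \<longrightarrow> x \<in> {0, 1} \<and> y \<in> {0, 1}) \<and>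
     (\<forall>i<n. \<forall>j<n. \<forall>x\<in>{0..1}. \<forall>y\<in>{0..1}.
        i \<noteq> j \<and> \<sigma> i x = \<sigma> j y \<longrightarrow> x \<in> {0, 1} \<and> y \<in> {0, 1})"

definition network :: "plane set \<Rightarrow> nat \<Rightarrow> (nat \<Rightarrow> real \<Rightarrow> plane) \<Rightarrow> bool" where
  "network \<Omega> n \<sigma> \<longleftrightarrow>
     (\<forall>i<n. regular_C1_curve (\<sigma> i)) \<and>
     network_set n \<sigma> \<subseteq> closure \<Omega> \<and>
     connected (network_set n \<sigma>) \<and>
     embedded n \<sigma> \<and>
     (\<forall>i<n. \<forall>x\<in>{0..1}. \<sigma> i x \<in> frontier \<Omega> \<longrightarrow> x \<in> {0, 1}) \<and>
     (\<forall>(i, x)\<in>curve_ends n. \<sigma> i x \<in> frontier \<Omega> \<longrightarrow> ends_at n \<sigma> (\<sigma> i x) = {(i, x)}) \<and>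
     multi_points n \<sigma> \<subseteq> \<Omega> \<and>
     end_points n \<sigma> \<subseteq> frontier \<Omega>"

text \<open>The unit tangent at a curve end, oriented away from the vertex.\<close>

definition outward_tangent :: "(nat \<Rightarrow> real \<Rightarrow> plane) \<Rightarrow> nat \<times> real \<Rightarrow> plane" where
  "outward_tangent \<sigma> = (\<lambda>(i, x). if x = 0 then unit_tangent (\<sigma> i) x else - unit_tangent (\<sigma> i) x)"

definition regular_network :: "plane set \<Rightarrow> nat \<Rightarrow> (nat \<Rightarrow> real \<Rightarrow> plane) \<Rightarrow> bool" where
  "regular_network \<Omega> n \<sigma> \<longleftrightarrow> network \<Omega> n \<sigma> \<and>
     (\<forall>p\<in>multi_points n \<sigma>. card (ends_at n \<sigma> p) = 3 \<and>
                            (\<Sum>e\<in>ends_at n \<sigma> p. outward_tangent \<sigma> e) = 0)"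


subsection \<open>Parabolic Hoelder spaces\<close>

definition dt :: "real set \<Rightarrow> (real \<Rightarrow> real \<Rightarrow> plane) \<Rightarrow> real \<Rightarrow> real \<Rightarrow> plane" where
  "dt J u t x = vector_derivative (\<lambda>s. u s x) (at t within J)"

definition holder_in_space :: "real \<Rightarrow> real set \<Rightarrow> (real \<Rightarrow> real \<Rightarrow> plane) \<Rightarrow> bool" where
  "holder_in_space \<beta> J f \<longleftrightarrow>
     (\<exists>C. \<forall>t\<in>J. \<forall>x\<in>{0..1}. \<forall>y\<in>{0..1}. norm (f t x - f t y) \<le> C * \<bar>x - y\<bar> powr \<beta>)"

definition holder_in_time :: "real \<Rightarrow> real set \<Rightarrow> (real \<Rightarrow> real \<Rightarrow> plane) \<Rightarrow> bool" where
  "holder_in_time \<beta> J f \<longleftrightarrow>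
     (\<exists>C. \<forall>x\<in>{0..1}. \<forall>s\<in>J. \<forall>t\<in>J. norm (f s x - f t x) \<le> C * \<bar>s - t\<bar> powr \<beta>)"

definition bounded_continuous :: "real set \<Rightarrow> (real \<Rightarrow> real \<Rightarrow> plane) \<Rightarrow> bool" where
  "bounded_continuous J f \<longleftrightarrow>
     continuous_on (J \<times> {0..1}) (\<lambda>(t, x). f t x) \<and> bounded ((\<lambda>(t, x). f t x) ` (J \<times> {0..1}))"

text \<open>Finiteness of the usual norm of \<open>C\<close> with exponents \<open>((2 + \<alpha>)/2, 2 + \<alpha>)\<close> on
  \<open>J \<times> {0..1}\<close>: the sup norms of \<open>u\<close>, \<open>u\<^sub>x\<close>, \<open>u\<^sub>x\<^sub>x\<close>, \<open>u\<^sub>t\<close>, the \<open>\<alpha>\<close>-seminorms in \<open>x\<close> of the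
  derivatives of parabolic order 2, and for each derivative of parabolic order \<open>m\<close> with
  \<open>0 < 2 + \<alpha> - m < 2\<close> the seminorm in \<open>t\<close> of exponent \<open>(2 + \<alpha> - m)/2\<close>.\<close>

definition parabolic_holder :: "real \<Rightarrow> real set \<Rightarrow> (real \<Rightarrow> real \<Rightarrow> plane) \<Rightarrow> bool" where
  "parabolic_holder \<alpha> J u \<longleftrightarrow>
     (let ux = (\<lambda>t. dx (u t)); uxx = (\<lambda>t. dx (dx (u t))); ut = dt J u in
      (\<forall>t\<in>J. u t differentiable_on {0..1} \<and> ux t differentiable_on {0..1}) \<and>
      (\<forall>x\<in>{0..1}. (\<lambda>t. u t x) differentiable_on J) \<and>
      bounded_continuous J u \<and> bounded_continuous J ux \<and>
      bounded_continuous J uxx \<and> bounded_continuous J ut \<and>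
      holder_in_space \<alpha> J uxx \<and> holder_in_space \<alpha> J ut \<and>
      holder_in_time ((1 + \<alpha>) / 2) J ux \<and>
      holder_in_time (\<alpha> / 2) J uxx \<and> holder_in_time (\<alpha> / 2) J ut)"


subsection \<open>Curvature flow with fixed end-points\<close>

definition time_interval :: "ereal \<Rightarrow> real set" where
  "time_interval T = {t. 0 \<le> t \<and> ereal t < T}"

text \<open>\<open>\<gamma> i t x\<close> is the point with parameter \<open>x\<close> of the \<open>i\<close>-th curve at time \<open>t\<close>, and \<open>\<sigma>\<close> is
  the initial network. Regularity on the half-open time interval is regularity on each of its
  subintervals \<open>{0..S}\<close>, the Hoelder constants being allowed to blow up at \<open>T\<close>. The concurring
  curve ends are read off from \<open>\<sigma>\<close>, so the combinatorial structure is the initial one. The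
  moving curves are not assumed to stay in \<open>closure \<Omega>\<close> or to stay embedded.\<close>

definition curvature_flow ::
  "plane set \<Rightarrow> nat \<Rightarrow> (nat \<Rightarrow> real \<Rightarrow> plane) \<Rightarrow> real \<Rightarrow> ereal \<Rightarrow>
     (nat \<Rightarrow> real \<Rightarrow> real \<Rightarrow> plane) \<Rightarrow> bool" where
  "curvature_flow \<Omega> n \<sigma> \<alpha> T \<gamma> \<longleftrightarrow>
     0 < T \<and> 0 < \<alpha> \<and> \<alpha> < 1 \<and>
     (\<forall>i<n. \<forall>S. 0 < S \<and> ereal S < T \<longrightarrow> parabolic_holder \<alpha> {0..S} (\<gamma> i)) \<and>
     (\<forall>i<n. \<forall>x\<in>{0..1}. \<gamma> i 0 x = \<sigma> i x) \<and>
     (\<forall>t\<in>time_interval T.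
        (\<forall>i<n. \<forall>x\<in>{0..1}. dx (\<gamma> i t) x \<noteq> 0) \<and>
        (\<forall>i<n. \<forall>x\<in>{0..1}.
           normal_component (\<gamma> i t) x (dt (time_interval T) (\<gamma> i) t x)
             = curvature_vector (\<gamma> i t) x) \<and>
        (\<forall>p\<in>multi_points n \<sigma>.
           (\<forall>(i, x)\<in>ends_at n \<sigma> p. \<forall>(j, y)\<in>ends_at n \<sigma> p. \<gamma> i t x = \<gamma> j t y) \<and>
           (\<Sum>e\<in>ends_at n \<sigma> p. outward_tangent (\<lambda>i. \<gamma> i t) e) = 0) \<and>
        (\<forall>p\<in>end_points n \<sigma>. \<forall>(i, x)\<in>ends_at n \<sigma> p. \<gamma> i t x = p))"

end

theory Submission
  imports Defs
begin

text \<open>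
  Both halves rest on minimum principles in which the triple junctions take care of themselves.

  For a supporting half-plane \<open>z \<bullet> e \<le> c\<close> of \<open>\<Omega>\<close>, the height \<open>c - \<gamma>\<^sup>i \<bullet> e\<close> solves on every edge a linear
  parabolic equation up to the ends of the edge. At a spatial minimum in a junction the three
  outward slopes are nonnegative and sum to zero, so all of them vanish and the equation can be
  evaluated there as in an interior point. Hence the height stays nonnegative; it becomes positive
  by the strong maximum principle, and the Hopf lemma excludes contact at junctions (again by the
  zero sum) and gives transversality at the fixed end-points.

  For embeddedness consider the squared distance \<open>|w|\<^sup>2\<close> of two points of the network. Pairs that are
  close to coinciding initially never meet unless they coincide initially, by the immersion property
  and the distinctness of the three tangents at a junction; pairs containing a fixed end-point never
  meet by the first half. On the remaining compact set of pairs the minimum cannot decrease: at a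
  minimal pair with \<open>w \<noteq> 0\<close> no point is a junction, since \<open>w\<close> would be orthogonal to three unit
  vectors with sum zero, and in a pair of interior points the two tangents are parallel, so that
  moving both points along them with unit speed gives \<open>\<partial>\<^sub>t |w|\<^sup>2 \<ge> 0\<close> from the second variation.
\<close>

section \<open>Minima of functions of one or two real variables\<close>

text \<open>Only points to the right of \<open>x\<close> are compared, so the left end-point is
  covered. With its mirror image this test gives the sign of outward slopes at curve ends, and the
  mirror image gives the sign of a time derivative even at the final time.\<close>

lemma local_min_deriv_nonneg:
  fixes f :: "real \<Rightarrow> real"
  assumes D: "(f has_real_derivative D) (at x within {p..q})"
    and min: "\<forall>\<^sub>F y in at x within {p..q}. f x \<le> f y"
    and x: "p \<le> x" "x < q"
  shows "0 \<le> D"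
proof (rule ccontr)
  assume "\<not> 0 \<le> D"
  then obtain d where d: "d > 0" "\<And>h. 0 < h \<Longrightarrow> x + h \<in> {p..q} \<Longrightarrow> h < d \<Longrightarrow> f (x + h) < f x"
    using has_real_derivative_neg_dec_right[OF D] by (metis not_le)
  obtain e where e: "e > 0" "\<And>y. y \<in> {p..q} \<Longrightarrow> y \<noteq> x \<Longrightarrow> dist y x < e \<Longrightarrow> f x \<le> f y"
    using min unfolding eventually_at by blast
  define h where "h = min (min d e / 2) (q - x)"
  have h: "0 < h" "h < d" "h < e" "h \<le> q - x"
    using d(1) e(1) x by (auto simp: h_def min_def)
  then have "f (x + h) < f x" "f x \<le> f (x + h)"
    using d(2)[of h] e(2)[of "x + h"] x by (auto simp: dist_real_def)
  then show False by simp
qed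

lemma local_min_deriv_nonpos:
  fixes f :: "real \<Rightarrow> real"
  assumes D: "(f has_real_derivative D) (at x within {p..q})"
    and min: "\<forall>\<^sub>F y in at x within {p..q}. f x \<le> f y"
    and x: "p < x" "x \<le> q"
  shows "D \<le> 0"
proof (rule ccontr)
  assume "\<not> D \<le> 0"
  then obtain d where d: "d > 0" "\<And>h. 0 < h \<Longrightarrow> x - h \<in> {p..q} \<Longrightarrow> h < d \<Longrightarrow> f (x - h) < f x"
    using has_real_derivative_pos_inc_left[OF D] by (metis not_le)
  obtain e where e: "e > 0" "\<And>y. y \<in> {p..q} \<Longrightarrow> y \<noteq> x \<Longrightarrow> dist y x < e \<Longrightarrow> f x \<le> f y"
    using min unfolding eventually_at by blast
  define h where "h = min (min d e / 2) (x - p)"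
  have h: "0 < h" "h < d" "h < e" "h \<le> x - p"
    using d(1) e(1) x by (auto simp: h_def min_def)
  then have "f (x - h) < f x" "f x \<le> f (x - h)"
    using d(2)[of h] e(2)[of "x - h"] x by (auto simp: dist_real_def)
  then show False by simp
qed

text \<open>A negative \<open>D\<close> would make \<open>f'\<close> negative just right of
  \<open>x\<close> and positive just left of it, so \<open>f\<close> would drop on whichever side
  lies in the interval. Criticality is assumed rather than derived, hence \<open>x\<close> may be an
  end-point; this lets junctions be treated like interior points.\<close>

lemma local_min_second_deriv_nonneg:
  fixes f f' :: "real \<Rightarrow> real"
  assumes f: "\<And>y. y \<in> {p..q} \<Longrightarrow> (f has_real_derivative f' y) (at y within {p..q})"
    and D: "(f' has_real_derivative D) (at x within {p..q})" and crit: "f' x = 0"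
    and min: "\<forall>\<^sub>F y in at x within {p..q}. f x \<le> f y"
    and x: "x \<in> {p..q}" "p < q"
  shows "0 \<le> D"
proof (rule ccontr)
  assume neg: "\<not> 0 \<le> D"
  obtain d1 where d1: "d1 > 0" "\<And>h. 0 < h \<Longrightarrow> x + h \<in> {p..q} \<Longrightarrow> h < d1 \<Longrightarrow> f' (x + h) < 0"
    using has_real_derivative_neg_dec_right[OF D] neg crit by (metis not_le)
  obtain d2 where d2: "d2 > 0" "\<And>h. 0 < h \<Longrightarrow> x - h \<in> {p..q} \<Longrightarrow> h < d2 \<Longrightarrow> f' (x - h) > 0"
    using has_real_derivative_neg_dec_left[OF D] neg crit by (metis not_le)
  obtain e where e: "e > 0" "\<And>y. y \<in> {p..q} \<Longrightarrow> y \<noteq> x \<Longrightarrow> dist y x < e \<Longrightarrow> f x \<le> f y"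
    using min unfolding eventually_at by blast
  have cont: "continuous_on {p..q} f"
    by (rule DERIV_continuous_on[OF f])
  have interior: "(f has_real_derivative f' y) (at y)" if "p < y" "y < q" for y
    using f[of y] that at_within_interior[of y "{p..q}"] by auto
  consider "x < q" | "p < x" using x by force
  then show False
  proof cases
    case 1
    define h where "h = min (min d1 e / 2) (q - x)"
    have h: "0 < h" "h < d1" "h < e" "h \<le> q - x"
      using d1(1) e(1) 1 by (auto simp: h_def min_def)
    have "f (x + h) < f x"
    proof (rule DERIV_neg_imp_decreasing_open[where f = f])
      show "\<exists>y. (f has_real_derivative y) (at z) \<and> y < 0" if "x < z" "z < x + h" for z
        using interior[of z] d1(2)[of "z - x"] that h x by auto
      show "continuous_on {x..x + h} f"
        using cont by (rule continuous_on_subset) (use h x in auto)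
    qed (use h in auto)
    moreover have "f x \<le> f (x + h)" using e(2)[of "x + h"] h x by (auto simp: dist_real_def)
    ultimately show False by simp
  next
    case 2
    define h where "h = min (min d2 e / 2) (x - p)"
    have h: "0 < h" "h < d2" "h < e" "h \<le> x - p"
      using d2(1) e(1) 2 by (auto simp: h_def min_def)
    have "f (x - h) < f x"
    proof (rule DERIV_pos_imp_increasing_open[where f = f])
      show "\<exists>y. (f has_real_derivative y) (at z) \<and> y > 0" if "x - h < z" "z < x" for z
        using interior[of z] d2(2)[of "x - z"] that h x by auto
      show "continuous_on {x - h..x} f"
        using cont by (rule continuous_on_subset) (use h x in auto)
    qed (use h in auto)
    moreover have "f x \<le> f (x - h)" using e(2)[of "x - h"] h x by (auto simp: dist_real_def)
    ultimately show False by simp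
  qed
qed

section \<open>Minimum principles in space and time\<close>

text \<open>A negative minimum over the cylinder lies neither at time 0 nor on the lateral sides. At
  such a minimum the slope vanishes, the second derivative is nonnegative and the time derivative is
  nonpositive, against the strict inequality.\<close>

lemma strict_parabolic_min_principle:
  fixes H :: "real \<Rightarrow> real \<Rightarrow> real"
  assumes cont: "continuous_on ({0..S} \<times> {p..q}) (\<lambda>(t, x). H t x)"
    and dx: "\<And>t x. t \<in> {0<..S} \<Longrightarrow> x \<in> {p..q} \<Longrightarrow> (H t has_real_derivative Hx t x) (at x within {p..q})"
    and dxx: "\<And>t x. t \<in> {0<..S} \<Longrightarrow> x \<in> {p..q} \<Longrightarrow> (Hx t has_real_derivative Hxx t x) (at x within {p..q})"
    and dt: "\<And>t x. t \<in> {0<..S} \<Longrightarrow> x \<in> {p..q} \<Longrightarrow> ((\<lambda>s. H s x) has_real_derivative Ht t x) (at t within {0..S})"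
    and super: "\<And>t x. t \<in> {0<..S} \<Longrightarrow> x \<in> {p<..<q} \<Longrightarrow> a t x * Hxx t x + b t x * Hx t x < Ht t x"
    and a: "\<And>t x. t \<in> {0<..S} \<Longrightarrow> x \<in> {p..q} \<Longrightarrow> 0 \<le> a t x"
    and init: "\<And>x. x \<in> {p..q} \<Longrightarrow> 0 \<le> H 0 x"
    and lateral: "\<And>t. t \<in> {0..S} \<Longrightarrow> 0 \<le> H t p" "\<And>t. t \<in> {0..S} \<Longrightarrow> 0 \<le> H t q"
    and tx: "t \<in> {0..S}" "x \<in> {p..q}"
  shows "0 \<le> H t x"
proof (rule ccontr)
  assume neg: "\<not> 0 \<le> H t x"
  have "compact ({0..S} \<times> {p..q})" by (intro compact_Times compact_Icc)
  then obtain z where z: "z \<in> {0..S} \<times> {p..q}"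
    "\<And>w. w \<in> {0..S} \<times> {p..q} \<Longrightarrow> (\<lambda>(t, x). H t x) z \<le> (\<lambda>(t, x). H t x) w"
    using continuous_attains_inf[OF _ _ cont] tx by blast
  obtain t1 x1 where z_eq: "z = (t1, x1)" by force
  have min: "H t1 x1 \<le> H s y" if "s \<in> {0..S}" "y \<in> {p..q}" for s y
    using z(2)[of "(s, y)"] that z_eq by auto
  have H1: "H t1 x1 < 0" using min[OF tx] neg by simp
  have t1: "t1 \<in> {0<..S}" and x1: "x1 \<in> {p<..<q}"
    using z(1) z_eq H1 init[of x1] lateral[of t1]
    by (auto simp: less_eq_real_def)
  have ev: "\<forall>\<^sub>F y in at x1 within {p..q}. H t1 x1 \<le> H t1 y"
    using min t1 by (auto simp: eventually_at_filter)
  have Hx0: "Hx t1 x1 = 0"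
    using local_min_deriv_nonneg[OF dx[OF t1] ev] local_min_deriv_nonpos[OF dx[OF t1] ev] x1 by auto
  have "0 \<le> Hxx t1 x1"
    by (rule local_min_second_deriv_nonneg[OF dx[OF t1] dxx[OF t1] Hx0 ev]) (use x1 in auto)
  moreover have "Ht t1 x1 \<le> 0"
    by (rule local_min_deriv_nonpos[OF dt])
       (use t1 x1 min in \<open>auto simp: eventually_at_filter\<close>)
  ultimately show False
    using super[OF t1 x1] mult_nonneg_nonneg[OF a[OF t1, of x1], of "Hxx t1 x1"] x1 Hx0 by simp
qed

text \<open>A zero that is not present initially would push the minimum of \<open>g t p + eps * t\<close> on the
  superlevel set \<open>{p. d \<le> g 0 p}\<close> below its values on the parabolic boundary. That set, unlike
  a metric neighbourhood, is invariant under identifications of points that \<open>g\<close> does not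
  distinguish, which is needed when \<open>P\<close> consists of pairs of curve parameters.\<close>

lemma zeros_stay_initial:
  fixes g :: "real \<Rightarrow> 'a::t2_space \<Rightarrow> real"
  assumes S: "0 < S" and P: "compact P" and cont: "continuous_on ({0..S} \<times> P) (\<lambda>(t, p). g t p)"
    and nonneg: "\<And>t p. 0 \<le> g t p"
    and isolated: "\<And>t p. t \<in> {0..S} \<Longrightarrow> p \<in> P \<Longrightarrow> g 0 p = 0 \<Longrightarrow>
      \<forall>\<^sub>F z in at (t, p) within {0..S} \<times> P. (case z of (s, q) \<Rightarrow> g s q = 0 \<longrightarrow> g 0 q = 0)"
    and "closed Bd"
    and Bd: "\<And>t p. t \<in> {0..S} \<Longrightarrow> p \<in> P \<Longrightarrow> p \<in> Bd \<Longrightarrow> g t p = 0 \<Longrightarrow> g 0 p = 0"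
    and no_min: "\<And>t p eps d. \<lbrakk>t \<in> {0<..S}; p \<in> P; p \<notin> Bd; 0 < eps; d < g 0 p;
      \<And>q. q \<in> P \<Longrightarrow> d < g 0 q \<Longrightarrow> g t p \<le> g t q;
      \<And>s. s \<in> {0..t} \<Longrightarrow> g t p + eps * t \<le> g s p + eps * s\<rbrakk> \<Longrightarrow> False"
    and tp: "t \<in> {0..S}" "p \<in> P" "g t p = 0"
  shows "g 0 p = 0"
proof (rule ccontr)
  assume moved: "g 0 p \<noteq> 0"
  have zero_in: "0 \<in> {0..S}" using S by simp
  have cont0: "continuous_on P (g 0)"
  proof -
    have "continuous_on P (\<lambda>q. (0::real, q))" by (intro continuous_intros)
    then have "continuous_on P (\<lambda>q. (\<lambda>(t, p). g t p) (0, q))"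
      by (rule continuous_on_compose2[OF cont]) (use zero_in in auto)
    then show ?thesis by simp
  qed
  \<comment> \<open>The new zeros together with their times. Limits of zeros are zeros, and
    \<open>isolated\<close> keeps new ones from accumulating at an initial zero, so this set is
    closed.\<close>
  define Z where "Z = {z \<in> {0..S} \<times> P. (case z of (s, q) \<Rightarrow> g s q = 0 \<and> g 0 q \<noteq> 0)}"
  have compSP: "compact ({0..S} \<times> P)" by (intro compact_Times compact_Icc P)
  have "closed Z"
    unfolding closed_limpt
  proof (intro allI impI)
    fix z assume z: "z islimpt Z"
    obtain s q where z_eq: "z = (s, q)" by force
    have zeros: "closed {z \<in> {0..S} \<times> P. (\<lambda>(t, p). g t p) z = 0}"
      using continuous_closed_preimage_constant[OF cont compact_imp_closed[OF compSP]] .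
    have "z islimpt {z \<in> {0..S} \<times> P. (\<lambda>(t, p). g t p) z = 0}"
      by (rule islimpt_subset[OF z]) (auto simp: Z_def)
    then have "z \<in> {z \<in> {0..S} \<times> P. (\<lambda>(t, p). g t p) z = 0}"
      using zeros unfolding closed_limpt by blast
    then have z0: "s \<in> {0..S}" "q \<in> P" "g s q = 0" by (simp_all add: z_eq)
    have "g 0 q \<noteq> 0"
    proof
      assume "g 0 q = 0"
      from isolated[OF z0(1,2) this]
      have "\<forall>\<^sub>F w in at z. w \<notin> Z"
        unfolding z_eq eventually_at_filter
        by (rule eventually_mono) (auto simp: Z_def)
      then show False using z by (simp add: islimpt_iff_eventually)
    qed
    then show "z \<in> Z" using z0 by (simp add: Z_def z_eq)
  qed
  then have "compact (({0..S} \<times> P) \<inter> Z)" by (intro compact_Int_closed compSP)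
  also have "({0..S} \<times> P) \<inter> Z = Z" by (auto simp: Z_def)
  finally have "compact (snd ` Z)"
    by (rule compact_continuous_image[OF continuous_on_snd[OF continuous_on_id]])
  moreover have "snd ` Z \<subseteq> P" "p \<in> snd ` Z"
    using tp moved by (force simp: Z_def)+
  ultimately obtain p0 where p0: "p0 \<in> snd ` Z" "\<And>q. q \<in> snd ` Z \<Longrightarrow> g 0 p0 \<le> g 0 q"
    using continuous_attains_inf[of "snd ` Z" "g 0"] continuous_on_subset[OF cont0] by blast
  \<comment> \<open>The points that acquire a new zero form a compact set, on which
    \<open>g 0\<close> has a positive minimum. Half of it leaves all of them strictly above the
    level \<open>d\<close>.\<close>
  define d where "d = g 0 p0 / 2"
  have "g 0 p0 \<noteq> 0" using p0(1) by (auto simp: Z_def)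
  then have d: "0 < d" "d < g 0 p0" using nonneg[of 0 p0] by (auto simp: d_def)
  have far: "d < g 0 q" if "s \<in> {0..S}" "q \<in> P" "g s q = 0" "g 0 q \<noteq> 0" for s q
  proof -
    have "q \<in> snd ` Z" using that by (force simp: Z_def)
    then show ?thesis using p0(2)[of q] d by simp
  qed
  define K where "K = {q \<in> P. d \<le> g 0 q}"
  \<comment> \<open>The parabolic boundary of the cylinder over \<open>K\<close>: initial time, the
    level \<open>d\<close>, and \<open>Bd\<close>. No zero of \<open>g\<close> lies on it, so the
    minimum \<open>c\<close> of \<open>g\<close> there is positive.\<close>
  define N where "N = {z \<in> {0..S} \<times> K. fst z = 0 \<or> g 0 (snd z) = d \<or> snd z \<in> Bd}"
  have "closed (P \<inter> g 0 -` {d..})"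
    using continuous_on_closed_vimage[OF compact_imp_closed[OF P], of "g 0"] cont0 closed_atLeast
    by (simp add: Int_commute)
  also have "P \<inter> g 0 -` {d..} = K" by (auto simp: K_def)
  finally have "compact (P \<inter> K)" by (rule compact_Int_closed[OF P])
  also have "P \<inter> K = K" by (auto simp: K_def)
  finally have K: "compact K" .
  have contK: "continuous_on ({0..S} \<times> K) (\<lambda>(t, p). g t p)"
    by (rule continuous_on_subset[OF cont]) (auto simp: K_def)
  have compSK: "compact ({0..S} \<times> K)" by (intro compact_Times compact_Icc K)
  have "closed N"
  proof -
    have "continuous_on ({0..S} \<times> K) (\<lambda>z. g 0 (snd z))"
      by (rule continuous_on_compose2[OF cont0 continuous_on_snd[OF continuous_on_id]]) (auto simp: K_def)
    then have "closed {z \<in> {0..S} \<times> K. g 0 (snd z) = d}"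
      by (rule continuous_closed_preimage_constant[OF _ compact_imp_closed[OF compSK]])
    moreover have "closed {z \<in> {0..S} \<times> K. fst z = 0}"
      by (intro continuous_closed_preimage_constant compact_imp_closed[OF compSK] continuous_intros)
    moreover have "closed (({0..S} \<times> K) \<inter> (UNIV \<times> Bd))"
      by (intro closed_Int closed_Times compact_imp_closed[OF compSK] closed_UNIV \<open>closed Bd\<close>)
    ultimately have "closed ({z \<in> {0..S} \<times> K. g 0 (snd z) = d} \<union> {z \<in> {0..S} \<times> K. fst z = 0} \<union>
        (({0..S} \<times> K) \<inter> (UNIV \<times> Bd)))"
      by (intro closed_Un)
    also have "{z \<in> {0..S} \<times> K. g 0 (snd z) = d} \<union> {z \<in> {0..S} \<times> K. fst z = 0} \<union>
        (({0..S} \<times> K) \<inter> (UNIV \<times> Bd)) = N"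
      by (auto simp: N_def)
    finally show ?thesis .
  qed
  then have "compact (({0..S} \<times> K) \<inter> N)" by (intro compact_Int_closed compSK)
  also have "({0..S} \<times> K) \<inter> N = N" by (auto simp: N_def)
  finally have compN: "compact N" .
  have pK: "p \<in> K" using far[OF tp moved] tp by (simp add: K_def)
  then have "(0, p) \<in> N" using zero_in by (simp add: N_def)
  then have "N \<noteq> {}" by blast
  moreover have "continuous_on N (\<lambda>(t, p). g t p)"
    by (rule continuous_on_subset[OF contK]) (auto simp: N_def)
  ultimately obtain z0 where z0: "z0 \<in> N" "\<And>z. z \<in> N \<Longrightarrow> (\<lambda>(t, p). g t p) z0 \<le> (\<lambda>(t, p). g t p) z"
    using continuous_attains_inf[OF compN] by blast
  define c where "c = (\<lambda>(t, p). g t p) z0"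
  have "c \<noteq> 0"
  proof
    assume c0: "c = 0"
    obtain s q where sq: "z0 = (s, q)" by force
    have q: "s \<in> {0..S}" "q \<in> P" "d \<le> g 0 q" "g s q = 0"
      using z0(1) c0 by (auto simp: sq N_def K_def c_def)
    then have "d < g 0 q" using far[OF q(1,2,4)] d by fastforce
    then have "s = 0 \<or> q \<in> Bd" using z0(1) by (auto simp: sq N_def)
    then show False using Bd[OF q(1,2) _ q(4)] q d by auto
  qed
  then have c: "0 < c" using nonneg by (cases z0) (auto simp: c_def less_le)
  \<comment> \<open>The penalty never exceeds \<open>c / 2\<close>. The penalized minimum is at most
    the value at the zero \<open>(t, p)\<close>, hence below \<open>c\<close>, and so it is not
    attained on \<open>N\<close>.\<close>
  define eps where "eps = c / (2 * S)"
  have eps: "0 < eps" using c S by (simp add: eps_def)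
  define G where "G = (\<lambda>z. (\<lambda>(t, p). g t p) z + eps * fst z)"
  have "continuous_on ({0..S} \<times> K) G"
    unfolding G_def by (intro continuous_intros contK)
  then obtain z1 where z1: "z1 \<in> {0..S} \<times> K" "\<And>z. z \<in> {0..S} \<times> K \<Longrightarrow> G z1 \<le> G z"
    using continuous_attains_inf[OF compSK] tp pK by blast
  obtain t1 p1 where t1p1: "z1 = (t1, p1)" by force
  have "G z1 \<le> G (t, p)" using z1(2) tp pK by simp
  also have "\<dots> \<le> eps * S" using tp eps by (simp add: G_def)
  also have "\<dots> < c" using c S by (simp add: eps_def)
  finally have small: "g t1 p1 + eps * t1 < c" by (simp add: G_def t1p1)
  have tp1: "t1 \<in> {0..S}" "p1 \<in> P" "d \<le> g 0 p1" "p1 \<in> K" using z1(1) by (auto simp: t1p1 K_def)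
  have "(t1, p1) \<notin> N"
  proof
    assume "(t1, p1) \<in> N"
    then have "c \<le> g t1 p1" using z0(2) by (auto simp: c_def)
    moreover have "0 \<le> eps * t1" using eps tp1 by simp
    ultimately show False using small by simp
  qed
  then have away: "t1 \<noteq> 0" "g 0 p1 \<noteq> d" "p1 \<notin> Bd" using tp1 by (auto simp: N_def)
  show False
  proof (rule no_min[of t1 p1 eps d])
    show "g t1 p1 \<le> g t1 q" if "q \<in> P" "d < g 0 q" for q
      using z1(2)[of "(t1, q)"] that tp1 by (auto simp: G_def t1p1 K_def)
    show "g t1 p1 + eps * t1 \<le> g s p1 + eps * s" if "s \<in> {0..t1}" for s
      using z1(2)[of "(s, p1)"] that tp1 by (auto simp: G_def t1p1)
  qed (use tp1 away eps in auto)
qed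

section \<open>The strong maximum principle and the Hopf lemma\<close>

text \<open>Multiplied by \<open>16 * k\<close> the expression is a square plus
  \<open>64 * k^2\<close>. The barrier of \<open>interior_pos\<close> leads to this quadratic, with
  its profile \<open>xi\<close> in place of \<open>y\<close>.\<close>

lemma quadratic_barrier_pos:
  fixes k C y :: real
  assumes "0 < k"
  shows "0 < 8 * k - C * y + C\<^sup>2 / (16 * k) * y\<^sup>2"
proof -
  have "16 * k * (8 * k - C * y + C\<^sup>2 / (16 * k) * y\<^sup>2) = (C * y - 8 * k)\<^sup>2 + 64 * k\<^sup>2"
    using assms by (simp add: field_simps power2_eq_square)
  also have "\<dots> > 0" using assms by (simp add: add_nonneg_pos)
  finally show ?thesis using assms by (simp add: zero_less_mult_iff)
qed

text \<open>Initial positivity is asked only inside the interval because an edge may start on the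
  boundary of the domain. The coefficients enter the barriers only through the bounds
  \<open>a0\<close>, \<open>A\<close> and \<open>B\<close>.\<close>

locale parabolic_solution =
  fixes S :: real and h hx hxx ht a b :: "real \<Rightarrow> real \<Rightarrow> real" and a0 A B :: real
  assumes hx: "\<And>t x. t \<in> {0..S} \<Longrightarrow> x \<in> {0..1} \<Longrightarrow> (h t has_real_derivative hx t x) (at x within {0..1})"
    and hxx: "\<And>t x. t \<in> {0..S} \<Longrightarrow> x \<in> {0..1} \<Longrightarrow> (hx t has_real_derivative hxx t x) (at x within {0..1})"
    and ht: "\<And>t x. t \<in> {0..S} \<Longrightarrow> x \<in> {0..1} \<Longrightarrow> ((\<lambda>s. h s x) has_real_derivative ht t x) (at t within {0..S})"
    and cont: "continuous_on ({0..S} \<times> {0..1}) (\<lambda>(t, x). h t x)"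
    and a: "\<And>t x. t \<in> {0..S} \<Longrightarrow> x \<in> {0..1} \<Longrightarrow> a0 \<le> a t x" "\<And>t x. t \<in> {0..S} \<Longrightarrow> x \<in> {0..1} \<Longrightarrow> a t x \<le> A"
    and a0: "0 < a0"
    and b: "\<And>t x. t \<in> {0..S} \<Longrightarrow> x \<in> {0..1} \<Longrightarrow> \<bar>b t x\<bar> \<le> B"
    and eq: "\<And>t x. t \<in> {0<..S} \<Longrightarrow> x \<in> {0..1} \<Longrightarrow> ht t x = a t x * hxx t x + b t x * hx t x"
    and nonneg: "\<And>t x. t \<in> {0..S} \<Longrightarrow> x \<in> {0..1} \<Longrightarrow> 0 \<le> h t x"
    and init: "\<And>x. x \<in> {0<..<1} \<Longrightarrow> 0 < h 0 x"
begin

lemma continuous_slice: "t \<in> {0..S} \<Longrightarrow> continuous_on {0..1} (h t)"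
  by (rule DERIV_continuous_on[OF hx])

lemma continuous_time: "x \<in> {0..1} \<Longrightarrow> continuous_on {0..S} (\<lambda>t. h t x)"
  by (rule DERIV_continuous_on[OF ht])

text \<open>As \<open>h\<close> solves the equation exactly and \<open>v\<close> is a strict
  subsolution, \<open>h - v\<close> satisfies the strict inequality of the minimum principle.
  Subrectangles are allowed because each barrier lives near one point only.\<close>

lemma comparison:
  fixes v vx vxx vt :: "real \<Rightarrow> real \<Rightarrow> real"
  assumes pq: "0 \<le> p" "q \<le> 1" "R \<le> S"
    and contv: "continuous_on ({0..R} \<times> {p..q}) (\<lambda>(t, x). v t x)"
    and vx: "\<And>t x. t \<in> {0<..R} \<Longrightarrow> x \<in> {p..q} \<Longrightarrow> (v t has_real_derivative vx t x) (at x within {p..q})"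
    and vxx: "\<And>t x. t \<in> {0<..R} \<Longrightarrow> x \<in> {p..q} \<Longrightarrow> (vx t has_real_derivative vxx t x) (at x within {p..q})"
    and vt: "\<And>t x. t \<in> {0<..R} \<Longrightarrow> x \<in> {p..q} \<Longrightarrow> ((\<lambda>s. v s x) has_real_derivative vt t x) (at t within {0..R})"
    and sub: "\<And>t x. t \<in> {0<..R} \<Longrightarrow> x \<in> {p<..<q} \<Longrightarrow> vt t x < a t x * vxx t x + b t x * vx t x"
    and init: "\<And>x. x \<in> {p..q} \<Longrightarrow> v 0 x \<le> h 0 x"
    and lateral: "\<And>t. t \<in> {0..R} \<Longrightarrow> v t p \<le> h t p" "\<And>t. t \<in> {0..R} \<Longrightarrow> v t q \<le> h t q"
    and tx: "t \<in> {0..R}" "x \<in> {p..q}"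
  shows "v t x \<le> h t x"
proof -
  have sub_t: "{0..R} \<subseteq> {0..S}" and sub_x: "{p..q} \<subseteq> {0..1}" using pq by auto
  have "0 \<le> h t x - v t x"
  proof (rule strict_parabolic_min_principle[where H = "\<lambda>t x. h t x - v t x" and a = a and b = b
        and Hx = "\<lambda>t x. hx t x - vx t x" and Hxx = "\<lambda>t x. hxx t x - vxx t x"
        and Ht = "\<lambda>t x. ht t x - vt t x", OF _ _ _ _ _ _ _ _ _ tx])
    have "continuous_on ({0..R} \<times> {p..q}) (\<lambda>(t, x). h t x)"
      using sub_t sub_x by (intro continuous_on_subset[OF cont]) auto
    from continuous_on_diff[OF this contv]
    show "continuous_on ({0..R} \<times> {p..q}) (\<lambda>(t, x). h t x - v t x)"
      by (simp add: case_prod_unfold)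
    fix t x assume t: "t \<in> {0<..R}"
    with sub_t have t': "t \<in> {0..S}" by auto
    show "((\<lambda>x. h t x - v t x) has_real_derivative hx t x - vx t x) (at x within {p..q})"
      if "x \<in> {p..q}"
      using that sub_x t' by (intro DERIV_diff vx[OF t] DERIV_subset[OF hx sub_x]) auto
    show "((\<lambda>x. hx t x - vx t x) has_real_derivative hxx t x - vxx t x) (at x within {p..q})"
      if "x \<in> {p..q}"
      using that sub_x t' by (intro DERIV_diff vxx[OF t] DERIV_subset[OF hxx sub_x]) auto
    show "((\<lambda>s. h s x - v s x) has_real_derivative ht t x - vt t x) (at t within {0..R})"
      if "x \<in> {p..q}"
      using that sub_x t' by (intro DERIV_diff vt[OF t] DERIV_subset[OF ht sub_t]) auto
    show "a t x * (hxx t x - vxx t x) + b t x * (hx t x - vx t x) < ht t x - vt t x"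
      if "x \<in> {p<..<q}"
      using sub[OF t that] eq[of t x] t t' that sub_x by (auto simp: algebra_simps)
    show "0 \<le> a t x" if "x \<in> {p..q}"
      using a(1)[OF t', of x] a0 that sub_x by auto
  qed (use init lateral in auto)
  then show ?thesis by simp
qed

text \<open>This is the strong maximum principle. A bump around \<open>x\<close> that lies below
  \<open>h\<close> initially, vanishes at the ends of its interval and decays exponentially in time
  stays below \<open>h\<close>, and it is still positive at \<open>x\<close> at time
  \<open>t\<close>.\<close>

lemma interior_pos:
  assumes t: "t \<in> {0..S}" and x: "x \<in> {0<..<1}"
  shows "0 < h t x"
proof -
  define r where "r = min x (1 - x) / 2"
  have r: "0 < r" "0 < x - r" "x + r < 1" using x by (auto simp: r_def min_def field_simps)
  have "\<exists>y\<in>{x - r..x + r}. \<forall>z\<in>{x - r..x + r}. h 0 y \<le> h 0 z"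
    using r t by (intro continuous_attains_inf continuous_on_subset[OF continuous_slice[of 0]]) auto
  then obtain m where m: "0 < m" "\<And>z. z \<in> {x - r..x + r} \<Longrightarrow> m \<le> h 0 z"
    using init r by (metis (no_types) atLeastAtMost_iff greaterThanLessThan_iff less_le_trans le_less_trans)
  \<comment> \<open>\<open>eps * exp (- M * s) * xi\<^sup>2\<close> with \<open>xi\<close> vanishing at \<open>x \<plusminus> r\<close> is a subsolution: near \<open>x \<plusminus> r\<close> the term
    \<open>2 a xi'\<^sup>2\<close> dominates, elsewhere the term \<open>M xi\<^sup>2\<close>.\<close>
  define k C M eps where "k = a0 * r\<^sup>2" and "C = 12 * A + 4 * B * r"
    and "M = C\<^sup>2 / (16 * k)" and "eps = m / r ^ 4"
  have k: "0 < k" and eps: "0 < eps" and M: "0 \<le> M"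
    using a0 r m(1) by (auto simp: k_def eps_def M_def)
  define xi where "xi y = r\<^sup>2 - (y - x)\<^sup>2" for y
  have xi: "0 \<le> xi y" "xi y \<le> r\<^sup>2" if "y \<in> {x - r..x + r}" for y
  proof -
    have "\<bar>y - x\<bar> \<le> r" using that by auto
    then have "(y - x)\<^sup>2 \<le> r\<^sup>2" by (metis abs_ge_zero power2_abs power_mono)
    then show "0 \<le> xi y" by (simp add: xi_def)
  qed (simp add: xi_def)
  define v where "v s y = eps * exp (- M * s) * (xi y)\<^sup>2" for s y
  have "v t x \<le> h t x"
  proof (rule comparison[where R = S and p = "x - r" and q = "x + r"
        and vx = "\<lambda>s y. eps * exp (- M * s) * (- 4 * (y - x) * xi y)"
        and vxx = "\<lambda>s y. eps * exp (- M * s) * (8 * r\<^sup>2 - 12 * xi y)"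
        and vt = "\<lambda>s y. - M * (eps * exp (- M * s)) * (xi y)\<^sup>2"])
    show "continuous_on ({0..S} \<times> {x - r..x + r}) (\<lambda>(s, y). v s y)"
      unfolding v_def xi_def case_prod_unfold by (intro continuous_intros)
  next
    fix s y assume s: "s \<in> {0<..S}" and y: "y \<in> {x - r..x + r}"
    show "(v s has_real_derivative eps * exp (- M * s) * (- 4 * (y - x) * xi y)) (at y within {x - r..x + r})"
      unfolding v_def xi_def by (auto intro!: derivative_eq_intros)
    show "((\<lambda>y. eps * exp (- M * s) * (- 4 * (y - x) * xi y)) has_real_derivative
        eps * exp (- M * s) * (8 * r\<^sup>2 - 12 * xi y)) (at y within {x - r..x + r})"
      unfolding xi_def
      by (rule derivative_eq_intros refl | simp)+ (simp add: algebra_simps power2_eq_square)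
    show "((\<lambda>s. v s y) has_real_derivative - M * (eps * exp (- M * s)) * (xi y)\<^sup>2) (at s within {0..S})"
      unfolding v_def by (auto intro!: derivative_eq_intros)
  next
    fix s y assume s: "s \<in> {0<..S}" and y: "y \<in> {x - r<..<x + r}"
    have s': "s \<in> {0..S}" and y': "y \<in> {0..1}" and yr: "y \<in> {x - r..x + r}" using s y r by auto
    have "0 < 8 * k - C * xi y + M * (xi y)\<^sup>2"
      using quadratic_barrier_pos[OF k] by (simp add: M_def)
    \<comment> \<open>\<open>8 * k\<close> bounds from below the second order contribution free of
      \<open>xi\<close>. \<open>C\<close> bounds the coefficient of \<open>xi\<close>:
      \<open>12 * A\<close> comes from the second order term, \<open>4 * B * r\<close> from the
      drift because \<open>y\<close> is within \<open>r\<close> of \<open>x\<close>.\<close>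
    also have "\<dots> \<le> a s y * (8 * r\<^sup>2 - 12 * xi y) + b s y * (- 4 * (y - x) * xi y) + M * (xi y)\<^sup>2"
    proof -
      have "a0 * (8 * r\<^sup>2) \<le> a s y * (8 * r\<^sup>2)" "a s y * (12 * xi y) \<le> A * (12 * xi y)"
        using a[OF s' y'] xi[OF yr] by (auto intro!: mult_right_mono)
      moreover have "b s y * (4 * (y - x) * xi y) \<le> B * r * (4 * xi y)"
      proof -
        have "\<bar>b s y * (y - x)\<bar> \<le> B * r"
          unfolding abs_mult using b[OF s' y'] yr by (intro mult_mono) auto
        then have "b s y * (y - x) * (4 * xi y) \<le> B * r * (4 * xi y)"
          using xi[OF yr] by (intro mult_right_mono) auto
        then show ?thesis by (simp add: algebra_simps)
      qed
      ultimately show ?thesis by (simp add: k_def C_def algebra_simps)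
    qed
    finally have "0 < eps * exp (- M * s) *
        (a s y * (8 * r\<^sup>2 - 12 * xi y) + b s y * (- 4 * (y - x) * xi y) + M * (xi y)\<^sup>2)"
      using eps by simp
    then show "- M * (eps * exp (- M * s)) * (xi y)\<^sup>2 <
        a s y * (eps * exp (- M * s) * (8 * r\<^sup>2 - 12 * xi y)) +
        b s y * (eps * exp (- M * s) * (- 4 * (y - x) * xi y))"
      by (simp add: algebra_simps)
  next
    fix y assume y: "y \<in> {x - r..x + r}"
    have "(xi y)\<^sup>2 \<le> (r\<^sup>2)\<^sup>2" using xi[OF y] by (intro power_mono) auto
    then have "eps * (xi y)\<^sup>2 \<le> eps * r ^ 4" using eps by simp
    also have "\<dots> = m" using r by (simp add: eps_def)
    finally show "v 0 y \<le> h 0 y" using m(2)[OF y] by (simp add: v_def)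
  next
    fix s assume "s \<in> {0..S}"
    then show "v s (x - r) \<le> h s (x - r)" "v s (x + r) \<le> h s (x + r)"
      using nonneg[of s] r by (auto simp: v_def xi_def)
  qed (use r t in auto)
  moreover have "0 < v t x" using eps r by (simp add: v_def xi_def)
  ultimately show ?thesis by simp
qed

text \<open>The sign \<open>w\<close> points into the interval. An exponential barrier with positive
  inward slope at \<open>x0\<close> lies below \<open>h\<close> and agrees with it at
  \<open>(T, x0)\<close>, so the inward slope of \<open>h\<close> is at least that of the
  barrier.\<close>

lemma hopf:
  assumes T: "T \<in> {0<..S}" and x0: "x0 \<in> {0, 1}" and w: "w = (if x0 = 0 then 1 else - 1)"
    and zero: "h T x0 = 0"
  shows "0 < w * hx T x0"
proof -
  have B: "0 \<le> B" using b[of T x0] T x0 by fastforce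
  \<comment> \<open>Large enough for the second order term \<open>a0 * beta^2\<close> to beat the
    drift \<open>B * beta\<close> by more than 1, which absorbs the time derivative
    \<open>eps\<close> of the barrier.\<close>
  define beta where "beta = (B + 1) / a0 + 1"
  have beta: "1 < beta" "a0 * beta\<^sup>2 - B * beta > 1"
  proof -
    show beta1: "1 < beta" using B a0 by (simp add: beta_def)
    have "1 < a0 * beta - B" using a0 by (simp add: beta_def field_simps)
    then have "1 * 1 < beta * (a0 * beta - B)" using beta1 by (intro mult_strict_mono) auto
    then show "a0 * beta\<^sup>2 - B * beta > 1" by (simp add: algebra_simps power2_eq_square)
  qed
  \<comment> \<open>Keeps \<open>exp (beta * d) - 1\<close> at most \<open>T\<close>. This bounds
    the barrier by 0 at time 0 and by \<open>eps * T = m\<close> at \<open>x1\<close>, while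
    \<open>d <= 1/2\<close> keeps \<open>x1\<close> inside the interval.\<close>
  define d where "d = min (1/2) (ln (1 + T) / beta)"
  have d: "0 < d" "d \<le> 1/2" using T beta by (auto simp: d_def min_def)
  have expd: "exp (beta * d) \<le> 1 + T"
  proof -
    have "beta * d \<le> ln (1 + T)"
      using beta by (auto simp: d_def min_def field_simps)
    then show ?thesis using T by (metis exp_le_cancel_iff exp_ln add_pos_pos zero_less_one greaterThanAtMost_iff)
  qed
  define x1 where "x1 = x0 + w * d"
  have x1: "x1 \<in> {0<..<1}" using d x0 by (auto simp: x1_def w)
  define p q where "p = min x0 x1" and "q = max x0 x1"
  have pq: "p < q" "0 \<le> p" "q \<le> 1" "{p..q} \<subseteq> {0..1}" "x0 \<in> {p..q}"
    using d x0 by (auto simp: p_def q_def x1_def w)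
  have oo: "w * w = 1" "\<bar>w\<bar> = 1" by (auto simp: w)
  have y: "0 \<le> w * (x - x0)" "w * (x - x0) \<le> d" if "x \<in> {p..q}" for x
    using that d x0 by (auto simp: p_def q_def x1_def w min_def max_def split: if_splits)
  have "\<exists>s\<in>{0..T}. \<forall>s'\<in>{0..T}. h s x1 \<le> h s' x1"
    using T x1 by (intro continuous_attains_inf continuous_on_subset[OF continuous_time]) auto
  then obtain m where m: "0 < m" "\<And>s. s \<in> {0..T} \<Longrightarrow> m \<le> h s x1"
    using interior_pos[OF _ x1] T by (metis atLeastAtMost_iff greaterThanAtMost_iff order_trans)
  define eps where "eps = m / T"
  have eps: "0 < eps" using m T by (simp add: eps_def)
  \<comment> \<open>The term \<open>T - s\<close> makes the barrier nonpositive at time \<open>0\<close>, where nothing is known near \<open>x0\<close>.\<close>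
  define v where "v s x = eps * (exp (beta * (w * (x - x0))) - 1 - (T - s))" for s x
  have v_x0: "v s x0 \<le> h s x0" if "s \<in> {0..T}" for s
  proof -
    have "v s x0 = - (eps * (T - s))" by (simp add: v_def algebra_simps)
    also have "\<dots> \<le> 0" using eps that by simp
    also have "0 \<le> h s x0" using nonneg[of s x0] that T x0 by auto
    finally show ?thesis .
  qed
  have v_x1: "v s x1 \<le> h s x1" if "s \<in> {0..T}" for s
  proof -
    have "v s x1 \<le> eps * T"
      unfolding v_def x1_def using eps expd that oo by (intro mult_left_mono) (auto simp: mult.assoc[symmetric])
    also have "\<dots> = m" using T by (simp add: eps_def)
    finally show ?thesis using m(2)[OF that] by simp
  qed
  have below: "v T x \<le> h T x" if x: "x \<in> {p..q}" for x
  proof (rule comparison[where R = T and p = p and q = q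
        and vx = "\<lambda>s x. eps * (beta * w) * exp (beta * (w * (x - x0)))"
        and vxx = "\<lambda>s x. eps * beta\<^sup>2 * exp (beta * (w * (x - x0)))"
        and vt = "\<lambda>s x. eps"])
    show "continuous_on ({0..T} \<times> {p..q}) (\<lambda>(s, x). v s x)"
      unfolding v_def case_prod_unfold by (intro continuous_intros)
  next
    fix s x assume "s \<in> {0<..T}" "x \<in> {p..q}"
    show "(v s has_real_derivative eps * (beta * w) * exp (beta * (w * (x - x0)))) (at x within {p..q})"
      unfolding v_def by (auto intro!: derivative_eq_intros)
    show "((\<lambda>x. eps * (beta * w) * exp (beta * (w * (x - x0)))) has_real_derivative
        eps * beta\<^sup>2 * exp (beta * (w * (x - x0)))) (at x within {p..q})"
      by (rule derivative_eq_intros refl | simp)+ (use oo in \<open>auto simp: power2_eq_square w\<close>)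
    show "((\<lambda>s. v s x) has_real_derivative eps) (at s within {0..T})"
      unfolding v_def by (auto intro!: derivative_eq_intros)
  next
    fix s x assume s: "s \<in> {0<..T}" and x: "x \<in> {p<..<q}"
    have s': "s \<in> {0..S}" and x': "x \<in> {0..1}" and xpq: "x \<in> {p..q}" using s x T pq by auto
    let ?E = "exp (beta * (w * (x - x0)))"
    have E: "1 \<le> ?E" using y(1)[OF xpq] beta by simp
    have "1 < a0 * beta\<^sup>2 - B * beta" by (fact beta(2))
    also have "\<dots> \<le> a s x * beta\<^sup>2 + b s x * w * beta"
    proof -
      have "a0 * beta\<^sup>2 \<le> a s x * beta\<^sup>2" using a(1)[OF s' x'] by (intro mult_right_mono) auto
      moreover have "\<bar>b s x * w\<bar> \<le> B" using b[OF s' x'] oo by (simp add: abs_mult)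
      then have "- B * beta \<le> b s x * w * beta" using beta by (intro mult_right_mono) auto
      ultimately show ?thesis by simp
    qed
    finally have "1 * 1 < (a s x * beta\<^sup>2 + b s x * w * beta) * ?E"
      using E by (intro mult_less_le_imp_less) auto
    then have "eps * 1 < eps * ((a s x * beta\<^sup>2 + b s x * w * beta) * ?E)"
      using eps by (intro mult_strict_left_mono) auto
    then show "eps < a s x * (eps * beta\<^sup>2 * ?E) + b s x * (eps * (beta * w) * ?E)"
      by (simp add: algebra_simps)
  next
    fix x assume x: "x \<in> {p..q}"
    have "exp (beta * (w * (x - x0))) \<le> 1 + T"
      using y(2)[OF x] beta by (intro order_trans[OF _ expd]) simp
    then have "v 0 x \<le> eps * 0"
      unfolding v_def using eps by (intro mult_left_mono) auto
    then show "v 0 x \<le> h 0 x" using nonneg[of 0 x] x pq T by auto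
  next
    fix s assume "s \<in> {0..T}"
    then show "v s p \<le> h s p" "v s q \<le> h s q"
      using v_x0[of s] v_x1[of s] by (auto simp: p_def q_def min_def max_def)
  qed (use pq T x in auto)
  have T': "T \<in> {0..S}" using T by simp
  have D: "((\<lambda>x. h T x - v T x) has_real_derivative hx T x0 - eps * (beta * w)) (at x0 within {p..q})"
    unfolding v_def using pq(5)
    by (auto intro!: derivative_eq_intros DERIV_subset[OF hx[OF T'] pq(4)] subsetD[OF pq(4)])
  have ev: "\<forall>\<^sub>F x in at x0 within {p..q}. h T x0 - v T x0 \<le> h T x - v T x"
    using below zero by (auto simp: eventually_at_filter v_def)
  have "0 \<le> w * (hx T x0 - eps * (beta * w))"
  proof (cases "x0 = 0")
    case True
    then show ?thesis
      using local_min_deriv_nonneg[OF D ev] d by (auto simp: w p_def q_def x1_def)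
  next
    case False
    then show ?thesis
      using local_min_deriv_nonpos[OF D ev] d x0 by (auto simp: w p_def q_def x1_def)
  qed
  then have "eps * beta \<le> w * hx T x0" using oo by (auto simp: w algebra_simps split: if_splits)
  moreover have "0 < eps * beta" using eps beta by simp
  ultimately show ?thesis by simp
qed

end

section \<open>Curves in the plane moving by curvature\<close>

lemma inner_plane: "u \<bullet> v = u $ 1 * v $ 1 + u $ 2 * v $ 2" for u v :: plane
  by (simp add: inner_vec_def sum_2)

lemma rot90_simps [simp]: "rot90 v $ 1 = - (v $ 2)" "rot90 v $ 2 = v $ 1"
  by (simp_all add: rot90_def)

lemma inner_rot90_self [simp]: "v \<bullet> rot90 v = 0"
  by (simp add: inner_plane)

lemma norm_rot90 [simp]: "norm (rot90 v) = norm v"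
  by (simp add: norm_eq_sqrt_inner inner_plane)

lemma plane_decompose:
  fixes v z :: plane
  assumes "v \<noteq> 0"
  shows "z = ((z \<bullet> v) / (norm v)\<^sup>2) *\<^sub>R v + ((z \<bullet> rot90 v) / (norm v)\<^sup>2) *\<^sub>R rot90 v"
proof -
  define N where "N = (norm v)\<^sup>2"
  have "N = v $ 1 * v $ 1 + v $ 2 * v $ 2"
    by (simp add: N_def power2_norm_eq_inner inner_plane)
  then have "N * z $ 1 = (z \<bullet> v) * v $ 1 - (z \<bullet> rot90 v) * v $ 2"
    "N * z $ 2 = (z \<bullet> v) * v $ 2 + (z \<bullet> rot90 v) * v $ 1"
    by (simp_all add: inner_plane algebra_simps)
  moreover have "N \<noteq> 0" using assms by (simp add: N_def)
  ultimately show ?thesis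
    unfolding N_def[symmetric] by (simp add: vec_eq_iff forall_2 field_simps)
qed

text \<open>Both vectors are multiples of \<open>rot90 w\<close>, and equal length leaves only a
  choice of sign.\<close>

lemma unit_vectors_orthogonal_to_same:
  fixes u v w :: plane
  assumes "norm u = 1" "norm v = 1" "w \<noteq> 0" "u \<bullet> w = 0" "v \<bullet> w = 0"
  shows "u = v \<or> u = - v"
proof -
  have u: "u = ((u \<bullet> rot90 w) / (norm w)\<^sup>2) *\<^sub>R rot90 w" 
    using plane_decompose[OF \<open>w \<noteq> 0\<close>, of u] assms by simp
  have v: "v = ((v \<bullet> rot90 w) / (norm w)\<^sup>2) *\<^sub>R rot90 w" 
    using plane_decompose[OF \<open>w \<noteq> 0\<close>, of v] assms by simp
  define a b where "a = (u \<bullet> rot90 w) / (norm w)\<^sup>2" and "b = (v \<bullet> rot90 w) / (norm w)\<^sup>2"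
  have ab: "u = a *\<^sub>R rot90 w" "v = b *\<^sub>R rot90 w" using u v by (simp_all add: a_def b_def)
  then have "\<bar>a\<bar> * norm w = \<bar>b\<bar> * norm w" using assms(1,2) by simp
  then have "a = b \<or> a = - b" using assms(3) by auto
  then show ?thesis using ab by auto
qed

text \<open>If two of the vectors agreed, the third would have length 2. If all were orthogonal to a
  nonzero \<open>w\<close>, they would agree up to sign, so two of them would coincide. The first
  conclusion separates the edges at a junction, the second excludes junctions from minimal
  pairs.\<close>

lemma three_unit_vectors_sum_zero:
  fixes f :: "'a \<Rightarrow> plane"
  assumes "card E = 3" and unit: "\<And>e. e \<in> E \<Longrightarrow> norm (f e) = 1" and sum: "(\<Sum>e\<in>E. f e) = 0"
  shows "inj_on f E" and "(\<And>e. e \<in> E \<Longrightarrow> f e \<bullet> w = 0) \<Longrightarrow> w = 0"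
proof -
  have ne: False if "norm x = 1" "norm z = 1" "x + x + z = 0" for x z :: plane
  proof -
    have "z = - (2 *\<^sub>R x)" using that(3) by (simp add: add_eq_0_iff scaleR_2)
    then have "norm z = 2" using that(1) by simp
    then show False using that(2) by simp
  qed
  obtain p q r where E: "E = {p, q, r}" "p \<noteq> q" "q \<noteq> r" "p \<noteq> r"
    using \<open>card E = 3\<close> by (auto simp: card_3_iff)
  have s: "f p + f q + f r = 0" using sum E by (simp add: add.assoc)
  have pq: "f p \<noteq> f q" using ne[of "f p" "f r"] s unit E by auto
  have qr: "f q \<noteq> f r" using ne[of "f q" "f p"] s unit E by (auto simp: algebra_simps)
  have pr: "f p \<noteq> f r" using ne[of "f p" "f q"] s unit E by (auto simp: algebra_simps)
  show "inj_on f E" using pq qr pr E by (auto simp: inj_on_def)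
  show "w = 0" if w: "\<And>e. e \<in> E \<Longrightarrow> f e \<bullet> w = 0"
  proof (rule ccontr)
    assume "w \<noteq> 0"
    then have "f p = - f q" "f r = - f q"
      using unit_vectors_orthogonal_to_same[of "f p" "f q" w] unit_vectors_orthogonal_to_same[of "f r" "f q" w]
        unit w E pq qr by auto
    then show False using pr by simp
  qed
qed

lemma has_real_derivative_height:
  fixes f :: "real \<Rightarrow> 'a::real_inner"
  assumes "(f has_vector_derivative D) F"
  shows "((\<lambda>x. c - f x \<bullet> e) has_real_derivative - (D \<bullet> e)) F"
proof -
  have "((\<lambda>x. f x \<bullet> e) has_vector_derivative D \<bullet> e) F"
    using assms by (rule bounded_linear.has_vector_derivative[OF bounded_linear_inner_left])
  then show ?thesis
    unfolding has_real_derivative_iff_has_vector_derivative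
    by (auto intro!: derivative_eq_intros)
qed

lemma has_real_derivative_inner:
  fixes f g :: "real \<Rightarrow> 'a::real_inner"
  assumes "(f has_vector_derivative f') (at x within A)" "(g has_vector_derivative g') (at x within A)"
  shows "((\<lambda>x. f x \<bullet> g x) has_real_derivative f x \<bullet> g' + f' \<bullet> g x) (at x within A)"
proof -
  have "((\<lambda>x. f x \<bullet> g x) has_derivative (\<lambda>h. f x \<bullet> (h *\<^sub>R g') + (h *\<^sub>R f') \<bullet> g x)) (at x within A)"
    using assms unfolding has_vector_derivative_def by (intro has_derivative_inner)
  moreover have "(\<lambda>h. f x \<bullet> (h *\<^sub>R g') + (h *\<^sub>R f') \<bullet> g x) = (*) (f x \<bullet> g' + f' \<bullet> g x)"
    by (rule ext) (simp add: algebra_simps)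
  ultimately show ?thesis by (simp add: has_field_derivative_def)
qed

lemma has_real_derivative_norm_sq:
  fixes f :: "real \<Rightarrow> 'a::real_inner"
  assumes "(f has_vector_derivative D) (at x within A)"
  shows "((\<lambda>x. (norm (f x))\<^sup>2) has_real_derivative 2 * (f x \<bullet> D)) (at x within A)"
  using has_real_derivative_inner[OF assms assms]
  unfolding power2_norm_eq_inner inner_commute[of D "f x"] mult_2 .

section \<open>A single edge moving by curvature\<close>

text \<open>Motion by curvature prescribes only the normal velocity; \<open>b\<close> absorbs the
  remaining tangential part. In this form the law, paired with any fixed vector, is a scalar linear
  parabolic equation with the same coefficients.\<close>

locale flow_curve =
  fixes S :: real and u V :: "real \<Rightarrow> real \<Rightarrow> plane" and b :: "real \<Rightarrow> real \<Rightarrow> real" and B :: real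
  assumes S: "0 < S"
    and du: "\<And>t x. t \<in> {0..S} \<Longrightarrow> x \<in> {0..1} \<Longrightarrow> (u t has_vector_derivative dx (u t) x) (at x within {0..1})"
    and ddu: "\<And>t x. t \<in> {0..S} \<Longrightarrow> x \<in> {0..1} \<Longrightarrow>
      (dx (u t) has_vector_derivative dx (dx (u t)) x) (at x within {0..1})"
    and dtu: "\<And>t x. t \<in> {0..S} \<Longrightarrow> x \<in> {0..1} \<Longrightarrow> ((\<lambda>s. u s x) has_vector_derivative V t x) (at t within {0..S})"
    and cont: "continuous_on ({0..S} \<times> {0..1}) (\<lambda>(t, x). u t x)"
    and cont_dx: "continuous_on ({0..S} \<times> {0..1}) (\<lambda>(t, x). dx (u t) x)"
    and immersed: "\<And>t x. t \<in> {0..S} \<Longrightarrow> x \<in> {0..1} \<Longrightarrow> dx (u t) x \<noteq> 0"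
    and drift: "\<And>t x. t \<in> {0..S} \<Longrightarrow> x \<in> {0..1} \<Longrightarrow> \<bar>b t x\<bar> \<le> B"
    and flow: "\<And>t x. t \<in> {0<..S} \<Longrightarrow> x \<in> {0..1} \<Longrightarrow>
      V t x = (1 / (norm (dx (u t) x))\<^sup>2) *\<^sub>R dx (dx (u t)) x + b t x *\<^sub>R dx (u t) x"
begin

lemma continuous_slice: "t \<in> {0..S} \<Longrightarrow> continuous_on {0..1} (u t)"
  using du by (metis continuous_on_vector_derivative)

text \<open>Pairing \<open>flow\<close> with \<open>e\<close> gives the equation. The ellipticity
  bounds are the extrema of the inverse squared speed over a compact rectangle; the lower one is
  positive because the curves are immersed.\<close>

lemma height_solution:
  assumes "\<And>t x. t \<in> {0..S} \<Longrightarrow> x \<in> {0..1} \<Longrightarrow> u t x \<bullet> e \<le> c"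
    and "\<And>x. x \<in> {0<..<1} \<Longrightarrow> u 0 x \<bullet> e < c"
  shows "\<exists>a0 A. parabolic_solution S (\<lambda>t x. c - u t x \<bullet> e) (\<lambda>t x. - (dx (u t) x \<bullet> e))
    (\<lambda>t x. - (dx (dx (u t)) x \<bullet> e)) (\<lambda>t x. - (V t x \<bullet> e))
    (\<lambda>t x. 1 / (norm (dx (u t) x))\<^sup>2) b a0 A B"
proof -
  define a where "a = (\<lambda>(t, x). 1 / (norm (dx (u t) x))\<^sup>2)"
  have conta: "continuous_on ({0..S} \<times> {0..1}) a"
    using cont_dx immersed unfolding a_def case_prod_unfold by (intro continuous_intros) auto
  have comp: "compact ({0..S} \<times> {0..1::real})" "{0..S} \<times> {0..1::real} \<noteq> {}"
    using S by (auto intro: compact_Times)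
  obtain z where z: "z \<in> {0..S} \<times> {0..1}" "\<And>w. w \<in> {0..S} \<times> {0..1} \<Longrightarrow> a z \<le> a w"
    using continuous_attains_inf[OF comp conta] by blast
  obtain y where y: "\<And>w. w \<in> {0..S} \<times> {0..1} \<Longrightarrow> a w \<le> a y"
    using continuous_attains_sup[OF comp conta] by blast
  have "0 < a z" using z immersed by (auto simp: a_def)
  have "parabolic_solution S (\<lambda>t x. c - u t x \<bullet> e) (\<lambda>t x. - (dx (u t) x \<bullet> e))
    (\<lambda>t x. - (dx (dx (u t)) x \<bullet> e)) (\<lambda>t x. - (V t x \<bullet> e))
    (\<lambda>t x. 1 / (norm (dx (u t) x))\<^sup>2) b (a z) (a y) B"
  proof
    show "continuous_on ({0..S} \<times> {0..1}) (\<lambda>(t, x). c - u t x \<bullet> e)"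
      using cont unfolding case_prod_unfold by (intro continuous_intros)
    fix t x :: real assume t: "t \<in> {0..S}" and x: "x \<in> {0..1}"
    show "((\<lambda>x. c - u t x \<bullet> e) has_real_derivative - (dx (u t) x \<bullet> e)) (at x within {0..1})"
      by (rule has_real_derivative_height[OF du[OF t x]])
    show "((\<lambda>x. - (dx (u t) x \<bullet> e)) has_real_derivative - (dx (dx (u t)) x \<bullet> e)) (at x within {0..1})"
      using has_real_derivative_height[OF ddu[OF t x], of 0 e] by simp
    show "((\<lambda>s. c - u s x \<bullet> e) has_real_derivative - (V t x \<bullet> e)) (at t within {0..S})"
      by (rule has_real_derivative_height[OF dtu[OF t x]])
    show "a z \<le> 1 / (norm (dx (u t) x))\<^sup>2" "1 / (norm (dx (u t) x))\<^sup>2 \<le> a y"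
      using z(2)[of "(t, x)"] y[of "(t, x)"] t x by (auto simp: a_def)
    show "\<bar>b t x\<bar> \<le> B" by (rule drift[OF t x])
    show "0 \<le> c - u t x \<bullet> e" using assms(1)[OF t x] by simp
  next
    fix t x :: real assume "t \<in> {0<..S}" "x \<in> {0..1}"
    from flow[OF this] show "- (V t x \<bullet> e) =
        1 / (norm (dx (u t) x))\<^sup>2 * - (dx (dx (u t)) x \<bullet> e) + b t x * - (dx (u t) x \<bullet> e)"
      by (simp add: inner_add_left)
  qed (use \<open>0 < a z\<close> assms(2) in auto)
  then show ?thesis by blast
qed

lemma line_derivatives:
  assumes t: "t \<in> {0..S}" and x: "x + r * s \<in> {0<..<1}"
  shows "((\<lambda>s. u t (x + r * s)) has_vector_derivative r *\<^sub>R dx (u t) (x + r * s)) (at s within A)"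
    and "((\<lambda>s. dx (u t) (x + r * s)) has_vector_derivative r *\<^sub>R dx (dx (u t)) (x + r * s)) (at s within A)"
proof -
  have x': "x + r * s \<in> {0..1}" using x by simp
  have "at (x + r * s) within {0..1} = at (x + r * s)"
    by (rule at_within_interior) (use x in simp)
  then have u: "(u t has_vector_derivative dx (u t) (x + r * s)) (at (x + r * s))"
    and ux: "(dx (u t) has_vector_derivative dx (dx (u t)) (x + r * s)) (at (x + r * s))"
    using du[OF t x'] ddu[OF t x'] by simp_all
  have line: "((\<lambda>s. x + r * s) has_vector_derivative r) (at s)"
    by (auto intro!: derivative_eq_intros)
  show "((\<lambda>s. u t (x + r * s)) has_vector_derivative r *\<^sub>R dx (u t) (x + r * s)) (at s within A)"
    using vector_diff_chain_at[OF line u] unfolding comp_def by (rule has_vector_derivative_at_within)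
  show "((\<lambda>s. dx (u t) (x + r * s)) has_vector_derivative r *\<^sub>R dx (dx (u t)) (x + r * s)) (at s within A)"
    using vector_diff_chain_at[OF line ux] unfolding comp_def by (rule has_vector_derivative_at_within)
qed

text \<open>Continuity of the space derivative in both variables spreads its sign to a neighbourhood
  in space-time. The uniformity in \<open>s\<close> is the point: nearby parameters cannot begin to
  coincide at nearby times.\<close>

lemma locally_monotone:
  assumes t: "t \<in> {0..S}" and x: "x \<in> {0..1}" and pos: "0 < dx (u t) x \<bullet> xi"
  obtains d where "0 < d"
    "\<And>s y z. s \<in> {0..S} \<Longrightarrow> y \<in> {0..1} \<Longrightarrow> z \<in> {0..1} \<Longrightarrow> \<bar>s - t\<bar> < d \<Longrightarrow> \<bar>y - x\<bar> < d \<Longrightarrow>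
      \<bar>z - x\<bar> < d \<Longrightarrow> y < z \<Longrightarrow> u s y \<bullet> xi < u s z \<bullet> xi"
proof -
  define f where "f = (\<lambda>(t, x). dx (u t) x \<bullet> xi)"
  have "continuous_on ({0..S} \<times> {0..1}) f"
    using cont_dx unfolding f_def case_prod_unfold by (intro continuous_intros)
  then have "(f \<longlongrightarrow> f (t, x)) (at (t, x) within {0..S} \<times> {0..1})"
    using t x by (auto simp: continuous_on_def)
  then have "\<forall>\<^sub>F w in at (t, x) within {0..S} \<times> {0..1}. 0 < f w"
    using pos by (intro order_tendstoD) (auto simp: f_def)
  then obtain d where d: "0 < d"
    "\<And>w. w \<in> {0..S} \<times> {0..1} \<Longrightarrow> w \<noteq> (t, x) \<Longrightarrow> dist w (t, x) < d \<Longrightarrow> 0 < f w"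
    unfolding eventually_at by blast
  have fpos: "0 < dx (u s) y \<bullet> xi"
    if "s \<in> {0..S}" "y \<in> {0..1}" "\<bar>s - t\<bar> < d / 2" "\<bar>y - x\<bar> < d / 2" for s y
  proof (cases "(s, y) = (t, x)")
    case False
    have "dist (s, y) (t, x) \<le> \<bar>s - t\<bar> + \<bar>y - x\<bar>"
      unfolding dist_prod_def by (simp add: dist_real_def sqrt_sum_squares_le_sum_abs)
    then show ?thesis using d(2)[of "(s, y)"] False that by (auto simp: f_def)
  qed (use pos in auto)
  show thesis
  proof (rule that[of "d / 2"])
    fix s y z assume s: "s \<in> {0..S}" "\<bar>s - t\<bar> < d / 2" and y: "y \<in> {0..1}" "\<bar>y - x\<bar> < d / 2"
      and z: "z \<in> {0..1}" "\<bar>z - x\<bar> < d / 2" and yz: "y < z"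
    have sub: "{y..z} \<subseteq> {0..1}" using y z by auto
    have D: "((\<lambda>x. u s x \<bullet> xi) has_real_derivative dx (u s) v \<bullet> xi) (at v within {0..1})"
      if "v \<in> {0..1}" for v
      using bounded_linear.has_vector_derivative[OF bounded_linear_inner_left du[OF s(1) that]]
      by (simp add: has_real_derivative_iff_has_vector_derivative)
    show "u s y \<bullet> xi < u s z \<bullet> xi"
    proof (rule DERIV_pos_imp_increasing_open[where f = "\<lambda>x. u s x \<bullet> xi", OF yz])
      show "continuous_on {y..z} (\<lambda>x. u s x \<bullet> xi)"
        by (rule continuous_on_subset[OF DERIV_continuous_on[OF D] sub])
      fix v assume v: "y < v" "v < z"
      then have "v \<in> interior {0..1}" using y z by auto
      then have "((\<lambda>x. u s x \<bullet> xi) has_real_derivative dx (u s) v \<bullet> xi) (at v)"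
        using D[of v] at_within_interior[of v "{0..1}"] interior_subset by auto
      moreover have "\<bar>v - x\<bar> < d / 2" using v y(2) z(2) by arith
      then have "0 < dx (u s) v \<bullet> xi" by (intro fpos) (use v y z s in auto)
      ultimately show "\<exists>D. ((\<lambda>x. u s x \<bullet> xi) has_real_derivative D) (at v) \<and> 0 < D" by blast
    qed
  qed (use d in auto)
qed

end

section \<open>Networks stay inside convex domains\<close>

text \<open>Separation gives the weak inequality. Nudging \<open>z\<close> in direction
  \<open>e\<close> within a ball inside the open set makes it strict there, and the closed
  half-plane carries the weak form to the closure. For the empty set \<open>e = 0\<close>
  serves.\<close>

lemma open_convex_support:
  fixes \<Omega> :: "'a::euclidean_space set"
  assumes "open \<Omega>" "convex \<Omega>" "q \<notin> \<Omega>"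
  obtains e where "\<And>z. z \<in> \<Omega> \<Longrightarrow> z \<bullet> e < q \<bullet> e" "\<And>z. z \<in> closure \<Omega> \<Longrightarrow> z \<bullet> e \<le> q \<bullet> e"
proof (cases "\<Omega> = {}")
  case True
  show ?thesis by (rule that[of 0]) (use True in auto)
next
  case False
  obtain e k where e: "e \<noteq> 0" "\<And>z. z \<in> \<Omega> \<Longrightarrow> e \<bullet> z \<le> k" "k \<le> e \<bullet> q"
    using separating_hyperplane_sets[of \<Omega> "{q}"] assms False by auto
  have le: "z \<bullet> e \<le> q \<bullet> e" if "z \<in> \<Omega>" for z using e(2)[OF that] e(3) by (simp add: inner_commute)
  show ?thesis
  proof (rule that)
    show "z \<bullet> e < q \<bullet> e" if "z \<in> \<Omega>" for z
    proof -
      obtain d where d: "0 < d" "ball z d \<subseteq> \<Omega>"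
        using assms(1) \<open>z \<in> \<Omega>\<close> open_contains_ball by blast
      have "z + (d / (2 * norm e)) *\<^sub>R e \<in> ball z d" using d e(1) by (simp add: dist_norm)
      then have "(z + (d / (2 * norm e)) *\<^sub>R e) \<bullet> e \<le> q \<bullet> e" using d le by blast
      moreover have "0 < (d / (2 * norm e)) * (e \<bullet> e)" using d e(1) by simp
      ultimately show ?thesis by (simp add: inner_add_left)
    qed
    show "z \<bullet> e \<le> q \<bullet> e" if "z \<in> closure \<Omega>" for z
    proof -
      have "closed {z. z \<bullet> e \<le> q \<bullet> e}"
        using closed_halfspace_le[of e] by (simp add: inner_commute)
      then have "closure \<Omega> \<subseteq> {z. z \<bullet> e \<le> q \<bullet> e}" using le by (intro closure_minimal) auto
      then show ?thesis using that by auto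
    qed
  qed
qed

lemma outward_derivative_nonneg:
  fixes f :: "real \<Rightarrow> real"
  assumes "(f has_real_derivative D) (at x within {0..1})"
    and "\<forall>\<^sub>F y in at x within {0..1}. f x \<le> f y" and "x \<in> {0, 1}"
  shows "0 \<le> (if x = 0 then D else - D)"
  using local_min_deriv_nonneg[OF assms(1,2)] local_min_deriv_nonpos[OF assms(1,2)] assms(3) by auto

section \<open>The network on a compact time interval\<close>

text \<open>On a compact time interval the tangential coefficients are bounded, as the barriers
  require. Vertices are those of \<open>\<sigma>\<close> at all times; that the moving network stays
  in the domain and stays embedded is derived, not assumed.\<close>

locale network_flow =
  fixes \<Omega> :: "plane set" and n :: nat and \<sigma> :: "nat \<Rightarrow> real \<Rightarrow> plane" and S :: real
    and \<gamma> V :: "nat \<Rightarrow> real \<Rightarrow> real \<Rightarrow> plane" and b :: "nat \<Rightarrow> real \<Rightarrow> real \<Rightarrow> real" and B :: "nat \<Rightarrow> real"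
  assumes open_dom: "open \<Omega>" and convex_dom: "convex \<Omega>" and S_pos: "0 < S"
    and regular: "regular_network \<Omega> n \<sigma>"
    and edge_flow: "\<And>i. i < n \<Longrightarrow> flow_curve S (\<gamma> i) (V i) (b i) (B i)"
    and initial: "\<And>i x. i < n \<Longrightarrow> x \<in> {0..1} \<Longrightarrow> \<gamma> i 0 x = \<sigma> i x"
    and concur: "\<And>t p i x j y. t \<in> {0..S} \<Longrightarrow> p \<in> multi_points n \<sigma> \<Longrightarrow> (i, x) \<in> ends_at n \<sigma> p \<Longrightarrow>
      (j, y) \<in> ends_at n \<sigma> p \<Longrightarrow> \<gamma> i t x = \<gamma> j t y"
    and balance: "\<And>t p. t \<in> {0..S} \<Longrightarrow> p \<in> multi_points n \<sigma> \<Longrightarrow>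
      (\<Sum>e\<in>ends_at n \<sigma> p. outward_tangent (\<lambda>i. \<gamma> i t) e) = 0"
    and fixed: "\<And>t p i x. t \<in> {0..S} \<Longrightarrow> p \<in> end_points n \<sigma> \<Longrightarrow> (i, x) \<in> ends_at n \<sigma> p \<Longrightarrow> \<gamma> i t x = p"
begin

text \<open>Parameters rather than points of the plane, since embeddedness concerns coincidences of
  parameters. With discrete edge indices they form a compact space on which positions are
  continuous.\<close>

definition points :: "(nat \<times> real) set" where
  "points = {..<n} \<times> {0..1}"

definition boundary_ends :: "(nat \<times> real) set" where
  "boundary_ends = {(i, x) \<in> curve_ends n. \<sigma> i x \<in> end_points n \<sigma>}"

abbreviation tangent :: "real \<Rightarrow> nat \<times> real \<Rightarrow> plane" where
  "tangent t \<equiv> outward_tangent (\<lambda>i. \<gamma> i t)"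

lemma finite_curve_ends: "finite (curve_ends n)"
  by (simp add: curve_ends_def)

lemma finite_ends_at: "finite (ends_at n \<sigma> p)"
  by (rule finite_subset[OF _ finite_curve_ends]) (auto simp: ends_at_def)

lemma mem_ends_at: "(i, x) \<in> ends_at n \<sigma> p \<longleftrightarrow> i < n \<and> x \<in> {0, 1} \<and> \<sigma> i x = p"
  by (auto simp: ends_at_def curve_ends_def)

lemma is_network: "network \<Omega> n \<sigma>" and card_ends: "p \<in> multi_points n \<sigma> \<Longrightarrow> card (ends_at n \<sigma> p) = 3"
  using regular by (auto simp: regular_network_def)

text \<open>An end belongs to the set of ends at its own vertex, so that set has exactly one element
  or at least two.\<close>

lemma end_cases:
  assumes "i < n" "x \<in> {0, 1}"
  shows "(i, x) \<in> boundary_ends \<or> \<sigma> i x \<in> multi_points n \<sigma>"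
proof -
  have "(i, x) \<in> ends_at n \<sigma> (\<sigma> i x)" using assms by (simp add: mem_ends_at)
  then have "card (ends_at n \<sigma> (\<sigma> i x)) \<noteq> 0" using finite_ends_at by auto
  then show ?thesis
    using assms by (auto simp: boundary_ends_def curve_ends_def multi_points_def end_points_def)
qed

lemma boundary_endsD:
  assumes "(i, x) \<in> boundary_ends"
  shows "i < n" "x \<in> {0, 1}" "\<sigma> i x \<in> end_points n \<sigma>" "\<sigma> i x \<in> frontier \<Omega>"
    "ends_at n \<sigma> (\<sigma> i x) = {(i, x)}" "t \<in> {0..S} \<Longrightarrow> \<gamma> i t x = \<sigma> i x"
proof -
  show i: "i < n" "x \<in> {0, 1}" and e: "\<sigma> i x \<in> end_points n \<sigma>"
    using assms by (auto simp: boundary_ends_def curve_ends_def)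
  show "\<sigma> i x \<in> frontier \<Omega>" using e is_network by (auto simp: network_def)
  then show "ends_at n \<sigma> (\<sigma> i x) = {(i, x)}"
    using i is_network unfolding network_def curve_ends_def by force
  show "t \<in> {0..S} \<Longrightarrow> \<gamma> i t x = \<sigma> i x"
    using fixed[OF _ e, of t i x] i by (simp add: mem_ends_at)
qed

lemma initial_in_closure: "i < n \<Longrightarrow> x \<in> {0..1} \<Longrightarrow> \<sigma> i x \<in> closure \<Omega>"
  using is_network unfolding network_def network_set_def by blast

lemma initial_in_domain:
  assumes "(i, x) \<in> points" "(i, x) \<notin> boundary_ends"
  shows "\<sigma> i x \<in> \<Omega>"
proof (cases "x \<in> {0, 1}")
  case True
  then show ?thesis
    using end_cases[of i x] assms is_network by (auto simp: network_def points_def)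
next
  case False
  then have "\<sigma> i x \<notin> frontier \<Omega>"
    using assms(1) is_network unfolding network_def points_def by blast
  then show ?thesis
    using initial_in_closure[of i x] assms open_dom
    by (auto simp: points_def frontier_def interior_open)
qed

lemma compact_points: "compact points"
  unfolding points_def by (intro compact_Times compact_Icc finite_imp_compact) auto

lemma continuous_position: "continuous_on ({0..S} \<times> points) (\<lambda>(t, i, x). \<gamma> i t x)"
proof -
  have "{0..S} \<times> points = (\<Union>i\<in>{..<n}. {0..S} \<times> {i} \<times> {0..1})" by (auto simp: points_def)
  moreover have "continuous_on (\<Union>i\<in>{..<n}. {0..S} \<times> {i} \<times> {0..1}) (\<lambda>(t, i, x). \<gamma> i t x)"
  proof (rule continuous_on_closed_Union)
    show "closed ({0..S} \<times> {i} \<times> {0..1::real})" for i :: nat by (intro closed_Times) auto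
    fix i assume "i \<in> {..<n}"
    then interpret flow_curve S "\<gamma> i" "V i" "b i" "B i" using edge_flow by simp
    have "continuous_on ({0..S} \<times> {i} \<times> {0..1}) ((\<lambda>(t, x). \<gamma> i t x) \<circ> (\<lambda>z. (fst z, snd (snd z))))"
      by (intro continuous_on_compose continuous_intros continuous_on_subset[OF cont]) auto
    then show "continuous_on ({0..S} \<times> {i} \<times> {0..1}) (\<lambda>(t, i, x). \<gamma> i t x)"
      by (rule continuous_on_eq) auto
  qed auto
  ultimately show ?thesis by simp
qed

lemma norm_tangent:
  assumes "t \<in> {0..S}" "e \<in> ends_at n \<sigma> p"
  shows "norm (tangent t e) = 1"
proof -
  obtain i x where e: "e = (i, x)" by force
  then have "i < n" "x \<in> {0..1}" using assms(2) by (auto simp: mem_ends_at)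
  then have "dx (\<gamma> i t) x \<noteq> 0"
    using flow_curve.immersed[OF edge_flow] assms(1) by blast
  then have "norm (unit_tangent (\<gamma> i t) x) = 1" by (simp add: unit_tangent_def)
  then show ?thesis by (auto simp: e outward_tangent_def)
qed

text \<open>Normalization is multiplication by a positive factor, so sign conditions on outward
  tangents can be tested on parameter derivatives.\<close>

lemma tangent_inner:
  assumes "t \<in> {0..S}" "(i, x) \<in> ends_at n \<sigma> p"
  shows "0 < tangent t (i, x) \<bullet> w \<longleftrightarrow> 0 < (if x = 0 then dx (\<gamma> i t) x \<bullet> w else - (dx (\<gamma> i t) x \<bullet> w))"
    and "tangent t (i, x) \<bullet> w = 0 \<longleftrightarrow> dx (\<gamma> i t) x \<bullet> w = 0"
    and "tangent t (i, x) \<bullet> w \<le> 0 \<longleftrightarrow> (if x = 0 then dx (\<gamma> i t) x \<bullet> w else - (dx (\<gamma> i t) x \<bullet> w)) \<le> 0"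
proof -
  have "i < n" "x \<in> {0..1}" using assms(2) by (auto simp: mem_ends_at)
  then have nz: "0 < inverse (norm (dx (\<gamma> i t) x))"
    using flow_curve.immersed[OF edge_flow] assms(1) by simp
  then have eq: "tangent t (i, x) \<bullet> w = inverse (norm (dx (\<gamma> i t) x)) *
      (if x = 0 then dx (\<gamma> i t) x \<bullet> w else - (dx (\<gamma> i t) x \<bullet> w))"
    by (simp add: outward_tangent_def unit_tangent_def)
  show "0 < tangent t (i, x) \<bullet> w \<longleftrightarrow> 0 < (if x = 0 then dx (\<gamma> i t) x \<bullet> w else - (dx (\<gamma> i t) x \<bullet> w))"
    "tangent t (i, x) \<bullet> w \<le> 0 \<longleftrightarrow> (if x = 0 then dx (\<gamma> i t) x \<bullet> w else - (dx (\<gamma> i t) x \<bullet> w)) \<le> 0"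
    "tangent t (i, x) \<bullet> w = 0 \<longleftrightarrow> dx (\<gamma> i t) x \<bullet> w = 0"
    unfolding eq using nz by (auto simp: zero_less_mult_iff mult_le_0_iff)
qed

text \<open>Nonpositive numbers with sum zero all vanish. One-sided information along the three
  edges of a junction thus becomes criticality along each of them.\<close>

lemma balanced_signs:
  assumes t: "t \<in> {0..S}" and p: "p \<in> multi_points n \<sigma>"
    and sgn: "\<And>e. e \<in> ends_at n \<sigma> p \<Longrightarrow> tangent t e \<bullet> w \<le> 0"
    and e: "e \<in> ends_at n \<sigma> p"
  shows "tangent t e \<bullet> w = 0"
proof -
  have "(\<Sum>e\<in>ends_at n \<sigma> p. - (tangent t e \<bullet> w)) = 0"
    using balance[OF t p] by (simp add: sum_negf flip: inner_sum_left)
  then show ?thesis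
    using sum_nonneg_eq_0_iff[OF finite_ends_at, of p "\<lambda>e. - (tangent t e \<bullet> w)"] sgn e by auto
qed

section \<open>Weak and strict containment in half-planes\<close>

text \<open>The penalized height is minimized over all edges at once. A negative minimum is not at a
  fixed end-point, and at a junction the balance condition makes it critical, so the equation can be
  evaluated there as well.\<close>

lemma stays_in_halfplane:
  assumes half: "\<And>z. z \<in> closure \<Omega> \<Longrightarrow> z \<bullet> e \<le> c"
    and tz: "t \<in> {0..S}" "i < n" "x \<in> {0..1}"
  shows "\<gamma> i t x \<bullet> e \<le> c"
proof (rule ccontr)
  assume outside: "\<not> \<gamma> i t x \<bullet> e \<le> c"
  \<comment> \<open>Half the assumed violation divided by \<open>S\<close>: the penalty cannot lift
    the minimum to zero, yet it makes the inequality for the time derivative strict.\<close>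
  define eps where "eps = (\<gamma> i t x \<bullet> e - c) / (2 * S)"
  have eps: "0 < eps" using outside S_pos by (simp add: eps_def)
  define H where "H = (\<lambda>(t, z). c - (case z of (i, x) \<Rightarrow> \<gamma> i t x) \<bullet> e + eps * t)"
  have contH: "continuous_on ({0..S} \<times> points) H"
    using continuous_position unfolding H_def case_prod_unfold by (intro continuous_intros)
  have "compact ({0..S} \<times> points)" by (intro compact_Times compact_Icc compact_points)
  moreover have tz': "(t, i, x) \<in> {0..S} \<times> points" using tz by (simp add: points_def)
  ultimately obtain z where z: "z \<in> {0..S} \<times> points" "\<And>w. w \<in> {0..S} \<times> points \<Longrightarrow> H z \<le> H w"
    using continuous_attains_inf[OF _ _ contH] by blast
  obtain s j y where z_eq: "z = (s, j, y)" by (cases z) auto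
  have sjy: "s \<in> {0..S}" "j < n" "y \<in> {0..1}" using z(1) by (auto simp: z_eq points_def)
  have min: "c - \<gamma> j s y \<bullet> e + eps * s \<le> c - \<gamma> j' s' y' \<bullet> e + eps * s'"
    if "s' \<in> {0..S}" "j' < n" "y' \<in> {0..1}" for s' j' y'
    using z(2)[of "(s', j', y')"] that by (simp add: H_def z_eq points_def)
  have min_slice: "c - \<gamma> j s y \<bullet> e \<le> c - \<gamma> j' s y' \<bullet> e" if "j' < n" "y' \<in> {0..1}" for j' y'
    using min[OF sjy(1) that] by simp
  have neg: "c - \<gamma> j s y \<bullet> e < 0"
  proof -
    have "c - \<gamma> j s y \<bullet> e + eps * s \<le> c - \<gamma> i t x \<bullet> e + eps * t" by (rule min[OF tz])
    also have "\<dots> \<le> c - \<gamma> i t x \<bullet> e + eps * S" using eps tz by simp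
    also have "\<dots> < 0" using outside S_pos by (simp add: eps_def field_simps)
    moreover have "0 \<le> eps * s" using eps sjy by simp
    ultimately show ?thesis by simp
  qed
  have s: "s \<in> {0<..S}"
  proof -
    have "s \<noteq> 0"
      using neg half[OF initial_in_closure[OF sjy(2,3)]] initial[OF sjy(2,3)] by auto
    then show ?thesis using sjy(1) by auto
  qed
  interpret flow_curve S "\<gamma> j" "V j" "b j" "B j" using edge_flow sjy(2) .
  have crit: "dx (\<gamma> j s) y \<bullet> e = 0"
  proof (cases "y \<in> {0, 1}")
    case False
    have ev: "\<forall>\<^sub>F z in at y within {0..1}. c - \<gamma> j s y \<bullet> e \<le> c - \<gamma> j s z \<bullet> e"
      using min_slice[OF sjy(2)] by (auto simp: eventually_at_filter)
    show ?thesis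
      using local_min_deriv_nonneg[OF has_real_derivative_height[OF du[OF sjy(1,3)]] ev]
        local_min_deriv_nonpos[OF has_real_derivative_height[OF du[OF sjy(1,3)]] ev] sjy False by auto
  next
    case True
    define p where "p = \<sigma> j y"
    \<comment> \<open>A fixed end-point keeps its initial position in the closed domain, where the
      height is nonnegative.\<close>
    have "(j, y) \<notin> boundary_ends"
      using boundary_endsD(6)[OF _ sjy(1)] half[OF initial_in_closure[OF sjy(2,3)]] neg by auto
    then have p: "p \<in> multi_points n \<sigma>" using end_cases[OF sjy(2) True] by (simp add: p_def)
    have jy: "(j, y) \<in> ends_at n \<sigma> p" using True sjy by (simp add: p_def mem_ends_at)
    have "tangent s e' \<bullet> e \<le> 0" if "e' \<in> ends_at n \<sigma> p" for e'
    proof -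
      obtain k v where e': "e' = (k, v)" by force
      have kv: "k < n" "v \<in> {0, 1}" "v \<in> {0..1}" using that by (auto simp: e' mem_ends_at)
      have same: "\<gamma> k s v = \<gamma> j s y" by (rule concur[OF sjy(1) p _ jy]) (use that e' in simp)
      have ev: "\<forall>\<^sub>F z in at v within {0..1}. c - \<gamma> k s v \<bullet> e \<le> c - \<gamma> k s z \<bullet> e"
        using min_slice[OF kv(1)] by (auto simp: eventually_at_filter same)
      have "0 \<le> (if v = 0 then - (dx (\<gamma> k s) v \<bullet> e) else - (- (dx (\<gamma> k s) v \<bullet> e)))"
        by (rule outward_derivative_nonneg[OF has_real_derivative_height ev kv(2)])
           (rule flow_curve.du[OF edge_flow[OF kv(1)] sjy(1) kv(3)])
      then show ?thesis
        using tangent_inner(3)[OF sjy(1), of k v p e] that e' by (auto split: if_splits)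
    qed
    from balanced_signs[OF sjy(1) p this jy] show ?thesis
      using tangent_inner(2)[OF sjy(1) jy] by simp
  qed
  have "0 \<le> - (dx (dx (\<gamma> j s)) y \<bullet> e)"
  proof (rule local_min_second_deriv_nonneg[where f = "\<lambda>y. c - \<gamma> j s y \<bullet> e" and p = 0 and q = 1 and x = y])
    show "((\<lambda>y. c - \<gamma> j s y \<bullet> e) has_real_derivative - (dx (\<gamma> j s) z \<bullet> e)) (at z within {0..1})"
      if "z \<in> {0..1}" for z
      by (rule has_real_derivative_height[OF du[OF sjy(1) that]])
    show "((\<lambda>z. - (dx (\<gamma> j s) z \<bullet> e)) has_real_derivative - (dx (dx (\<gamma> j s)) y \<bullet> e)) (at y within {0..1})"
      using has_real_derivative_height[OF ddu[OF sjy(1,3)], of 0 e] by simp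
    show "\<forall>\<^sub>F z in at y within {0..1}. c - \<gamma> j s y \<bullet> e \<le> c - \<gamma> j s z \<bullet> e"
      using min_slice[OF sjy(2)] by (auto simp: eventually_at_filter)
  qed (use crit sjy in auto)
  \<comment> \<open>At a critical point the tangential part of the velocity is orthogonal to
    \<open>e\<close>, and only the second derivative remains.\<close>
  then have "V j s y \<bullet> e \<le> 0"
    by (simp add: flow[OF s sjy(3)] inner_add_left crit divide_nonpos_nonneg)
  moreover have "- (V j s y \<bullet> e) + eps \<le> 0"
  proof (rule local_min_deriv_nonpos)
    show "((\<lambda>s. (c - \<gamma> j s y \<bullet> e) + eps * s) has_real_derivative - (V j s y \<bullet> e) + eps) (at s within {0..S})"
      by (intro DERIV_add has_real_derivative_height[OF dtu[OF sjy(1,3)]])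
         (auto intro!: derivative_eq_intros)
    show "\<forall>\<^sub>F s' in at s within {0..S}. (c - \<gamma> j s y \<bullet> e) + eps * s \<le> (c - \<gamma> j s' y \<bullet> e) + eps * s'"
      using min[OF _ sjy(2,3)] by (auto simp: eventually_at_filter)
  qed (use s in auto)
  ultimately show False using eps by simp
qed

context
  fixes e :: plane and c :: real
  assumes open_half: "\<And>z. z \<in> \<Omega> \<Longrightarrow> z \<bullet> e < c" and closed_half: "\<And>z. z \<in> closure \<Omega> \<Longrightarrow> z \<bullet> e \<le> c"
begin

lemma height_solution_edge:
  assumes "i < n"
  shows "\<exists>a0 A. parabolic_solution S (\<lambda>t x. c - \<gamma> i t x \<bullet> e) (\<lambda>t x. - (dx (\<gamma> i t) x \<bullet> e))
    (\<lambda>t x. - (dx (dx (\<gamma> i t)) x \<bullet> e)) (\<lambda>t x. - (V i t x \<bullet> e))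
    (\<lambda>t x. 1 / (norm (dx (\<gamma> i t) x))\<^sup>2) (b i) a0 A (B i)"
proof (rule flow_curve.height_solution[OF edge_flow[OF assms]])
  show "\<gamma> i t x \<bullet> e \<le> c" if "t \<in> {0..S}" "x \<in> {0..1}" for t x
    by (rule stays_in_halfplane[OF closed_half that(1) assms that(2)])
  fix x :: real assume x: "x \<in> {0<..<1}"
  then have "(i, x) \<in> points" "(i, x) \<notin> boundary_ends"
    using assms by (auto simp: points_def boundary_ends_def curve_ends_def)
  then show "\<gamma> i 0 x \<bullet> e < c"
    using open_half[OF initial_in_domain[of i x]] initial[of i x] assms x by simp
qed

text \<open>The Hopf lemma for the height, which vanishes at the contact. It serves twice: for a
  contradiction at junctions and for transversality at the fixed end-points.\<close>

lemma outward_slope: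
  assumes t: "t \<in> {0<..S}" and ix: "(i, x) \<in> ends_at n \<sigma> p" and touch: "\<gamma> i t x \<bullet> e = c"
  shows "0 < tangent t (i, x) \<bullet> (- e)"
proof -
  have i: "i < n" "x \<in> {0, 1}" using ix by (auto simp: mem_ends_at)
  obtain a0 A where "parabolic_solution S (\<lambda>t x. c - \<gamma> i t x \<bullet> e) (\<lambda>t x. - (dx (\<gamma> i t) x \<bullet> e))
    (\<lambda>t x. - (dx (dx (\<gamma> i t)) x \<bullet> e)) (\<lambda>t x. - (V i t x \<bullet> e))
    (\<lambda>t x. 1 / (norm (dx (\<gamma> i t) x))\<^sup>2) (b i) a0 A (B i)"
    using height_solution_edge[OF i(1)] by blast
  from parabolic_solution.hopf[OF this t i(2) refl] touch show ?thesis
    using tangent_inner(1)[OF _ ix, of t "- e"] t by (auto split: if_splits)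
qed

text \<open>Inside an edge this is the strong maximum principle. A junction on the supporting line
  would have three tangents pointing strictly inwards, which cannot sum to zero. Time 0 is settled
  by the initial position, since the Hopf lemma speaks of positive times.\<close>

lemma strictly_in_halfplane:
  assumes t: "t \<in> {0..S}" and ix: "(i, x) \<in> points" "(i, x) \<notin> boundary_ends"
  shows "\<gamma> i t x \<bullet> e < c"
proof (cases "x \<in> {0, 1}")
  case False
  have i: "i < n" "x \<in> {0<..<1}" using ix False by (auto simp: points_def)
  obtain a0 A where "parabolic_solution S (\<lambda>t x. c - \<gamma> i t x \<bullet> e) (\<lambda>t x. - (dx (\<gamma> i t) x \<bullet> e))
    (\<lambda>t x. - (dx (dx (\<gamma> i t)) x \<bullet> e)) (\<lambda>t x. - (V i t x \<bullet> e))
    (\<lambda>t x. 1 / (norm (dx (\<gamma> i t) x))\<^sup>2) (b i) a0 A (B i)"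
    using height_solution_edge[OF i(1)] by blast
  from parabolic_solution.interior_pos[OF this t i(2)] show ?thesis by simp
next
  case True
  have i: "i < n" "x \<in> {0..1}" using ix by (auto simp: points_def)
  define p where "p = \<sigma> i x"
  have p: "p \<in> multi_points n \<sigma>" using end_cases[OF i(1) True] ix by (simp add: p_def)
  have ixp: "(i, x) \<in> ends_at n \<sigma> p" using i True by (simp add: p_def mem_ends_at)
  show ?thesis
  proof (rule ccontr)
    assume "\<not> \<gamma> i t x \<bullet> e < c"
    then have touch: "\<gamma> i t x \<bullet> e = c" using stays_in_halfplane[OF closed_half t i] by simp
    have "t \<noteq> 0"
      using touch open_half[OF initial_in_domain[OF ix]] initial[OF i] by auto
    then have t': "t \<in> {0<..S}" using t by auto
    have pos: "0 < tangent t e' \<bullet> (- e)" if "e' \<in> ends_at n \<sigma> p" for e'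
    proof -
      obtain j y where e': "e' = (j, y)" by force
      then have "\<gamma> j t y \<bullet> e = c" using concur[OF t p _ ixp] that touch by simp
      then show ?thesis using outward_slope[OF t'] that e' by blast
    qed
    have "tangent t e' \<bullet> e \<le> 0" if "e' \<in> ends_at n \<sigma> p" for e'
      using pos[OF that] by simp
    from balanced_signs[OF t p this ixp] pos[OF ixp] show False by simp
  qed
qed

end

text \<open>A point outside would lie on its own supporting line, against the strict bound for that
  line.\<close>

lemma stays_inside:
  assumes t: "t \<in> {0..S}" and ix: "(i, x) \<in> points" "(i, x) \<notin> boundary_ends"
  shows "\<gamma> i t x \<in> \<Omega>"
proof (rule ccontr)
  assume "\<gamma> i t x \<notin> \<Omega>"
  then obtain e where "\<And>z. z \<in> \<Omega> \<Longrightarrow> z \<bullet> e < \<gamma> i t x \<bullet> e" "\<And>z. z \<in> closure \<Omega> \<Longrightarrow> z \<bullet> e \<le> \<gamma> i t x \<bullet> e"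
    using open_convex_support[OF open_dom convex_dom] by metis
  from strictly_in_halfplane[OF this t ix] show False by simp
qed

lemma frontier_imp_boundary_end:
  assumes "t \<in> {0..S}" "(i, x) \<in> points" "\<gamma> i t x \<in> frontier \<Omega>"
  shows "(i, x) \<in> boundary_ends"
  using stays_inside[OF assms(1,2)] assms(3) open_dom by (auto simp: frontier_def interior_open)

end

section \<open>Distances between points of the network\<close>

context network_flow
begin

text \<open>The square keeps the distance differentiable where two points coincide.\<close>

definition gap :: "real \<Rightarrow> (nat \<times> real) \<times> (nat \<times> real) \<Rightarrow> real" where
  "gap t = (\<lambda>((i, x), (j, y)). (norm (\<gamma> i t x - \<gamma> j t y))\<^sup>2)"

lemma gap_eq [simp]: "gap t ((i, x), (j, y)) = (norm (\<gamma> i t x - \<gamma> j t y))\<^sup>2"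
  by (simp add: gap_def)

lemma gap_swap: "gap t (p, q) = gap t (q, p)"
  by (cases p; cases q) (simp add: norm_minus_commute)

lemma continuous_gap: "continuous_on ({0..S} \<times> (points \<times> points)) (\<lambda>(t, p). gap t p)"
proof -
  let ?X = "\<lambda>(t, i, x). \<gamma> i t x"
  have "continuous_on ({0..S} \<times> (points \<times> points)) (\<lambda>z. ?X (fst z, fst (snd z)))"
    by (rule continuous_on_compose2[OF continuous_position]) (auto intro!: continuous_intros)
  moreover have "continuous_on ({0..S} \<times> (points \<times> points)) (\<lambda>z. ?X (fst z, snd (snd z)))"
    by (rule continuous_on_compose2[OF continuous_position]) (auto intro!: continuous_intros)
  ultimately have "continuous_on ({0..S} \<times> (points \<times> points))
      (\<lambda>z. (norm (?X (fst z, fst (snd z)) - ?X (fst z, snd (snd z))))\<^sup>2)"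
    by (intro continuous_intros)
  then show ?thesis by (rule continuous_on_eq) (auto simp: gap_def)
qed

section \<open>Variations of the distance at a minimal pair\<close>

text \<open>Moving the junction point into each of its edges cannot decrease the distance to
  \<open>q\<close>, so every outward tangent has nonpositive product with \<open>w\<close>. By
  balance all products vanish, and three unit vectors with sum zero are orthogonal only to
  \<open>w = 0\<close>.\<close>

lemma junction_not_minimal:
  assumes t: "t \<in> {0..S}" and p: "p \<in> multi_points n \<sigma>" and ix: "(i, x) \<in> ends_at n \<sigma> p"
    and D: "\<gamma> i t x \<noteq> q"
    and min: "\<And>k v. (k, v) \<in> ends_at n \<sigma> p \<Longrightarrow>
      \<forall>\<^sub>F z in at v within {0..1}. (norm (\<gamma> k t v - q))\<^sup>2 \<le> (norm (\<gamma> k t z - q))\<^sup>2"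
  shows False
proof -
  define w where "w = q - \<gamma> i t x"
  have sgn: "tangent t e \<bullet> w \<le> 0" if e: "e \<in> ends_at n \<sigma> p" for e
  proof -
    obtain k v where kv: "e = (k, v)" by force
    then have k: "k < n" "v \<in> {0, 1}" "v \<in> {0..1}" using e by (auto simp: mem_ends_at)
    have same: "\<gamma> k t v = \<gamma> i t x" by (rule concur[OF t p _ ix]) (use e kv in simp)
    have "((\<lambda>z. \<gamma> k t z - q) has_vector_derivative dx (\<gamma> k t) v - 0) (at v within {0..1})"
      by (intro has_vector_derivative_diff flow_curve.du[OF edge_flow[OF k(1)] t k(3)] has_vector_derivative_const)
    from outward_derivative_nonneg[OF has_real_derivative_norm_sq[OF this] min k(2)] e kv
    have "0 \<le> (if v = 0 then 2 * ((\<gamma> k t v - q) \<bullet> dx (\<gamma> k t) v) else - (2 * ((\<gamma> k t v - q) \<bullet> dx (\<gamma> k t) v)))"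
      by (auto split: if_splits)
    moreover have "(\<gamma> k t v - q) \<bullet> dx (\<gamma> k t) v = - (dx (\<gamma> k t) v \<bullet> w)"
      by (simp add: w_def same inner_diff inner_commute)
    ultimately show ?thesis
      using tangent_inner(3)[OF t, of k v p w] e kv by (auto split: if_splits)
  qed
  have "w = 0"
    by (rule three_unit_vectors_sum_zero(2)[OF card_ends[OF p] norm_tangent[OF t] balance[OF t p]])
       (use balanced_signs[OF t p sgn] in auto)
  then show False using D by (simp add: w_def)
qed

text \<open>Minimality is known only among pairs whose initial gap exceeds \<open>d\<close>. As the
  edges concur at time 0 too, this open condition holds near the junction on each of its edges, so
  all three may be varied.\<close>

lemma end_not_minimal:
  assumes t: "t \<in> {0..S}" and ix: "(i, x) \<in> points" "(i, x) \<notin> boundary_ends" and jy: "(j, y) \<in> points"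
    and d: "d < gap 0 ((i, x), (j, y))"
    and min: "\<And>q. q \<in> points \<times> points \<Longrightarrow> d < gap 0 q \<Longrightarrow> gap t ((i, x), (j, y)) \<le> gap t q"
    and D: "\<gamma> i t x \<noteq> \<gamma> j t y"
  shows "x \<in> {0<..<1}"
proof (rule ccontr)
  assume "\<not> x \<in> {0<..<1}"
  then have i: "i < n" "x \<in> {0, 1}" using ix by (auto simp: points_def)
  define p where "p = \<sigma> i x"
  have p: "p \<in> multi_points n \<sigma>" using end_cases[OF i] ix by (simp add: p_def)
  have ixp: "(i, x) \<in> ends_at n \<sigma> p" using i by (simp add: p_def mem_ends_at)
  have zero: "0 \<in> {0..S}" using S_pos by simp
  show False
  proof (rule junction_not_minimal[OF t p ixp D])
    fix k v assume kv: "(k, v) \<in> ends_at n \<sigma> p"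
    have k: "k < n" "v \<in> {0..1}" using kv by (auto simp: mem_ends_at)
    have "continuous_on {0..1} (\<lambda>z. gap 0 ((k, z), (j, y)))"
      unfolding gap_eq
      by (intro continuous_intros flow_curve.continuous_slice[OF edge_flow[OF k(1)] zero])
    then have "((\<lambda>z. gap 0 ((k, z), (j, y))) \<longlongrightarrow> gap 0 ((k, v), (j, y))) (at v within {0..1})"
      using k(2) by (simp add: continuous_on_def)
    moreover have "d < gap 0 ((k, v), (j, y))"
      using d concur[OF zero p kv ixp] by simp
    ultimately have "\<forall>\<^sub>F z in at v within {0..1}. d < gap 0 ((k, z), (j, y))"
      by (rule order_tendstoD(1))
    moreover have "\<forall>\<^sub>F z in at v within {0..1}. z \<in> {0..1}"
      by (simp add: eventually_at_filter)
    ultimately show "\<forall>\<^sub>F z in at v within {0..1}. (norm (\<gamma> k t v - \<gamma> j t y))\<^sup>2 \<le> (norm (\<gamma> k t z - \<gamma> j t y))\<^sup>2"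
    proof eventually_elim
      case (elim z)
      then have "gap t ((i, x), (j, y)) \<le> gap t ((k, z), (j, y))"
        using k jy by (intro min) (auto simp: points_def)
      then show ?case using concur[OF t p kv ixp] by simp
    qed
  qed
qed

text \<open>The two parameters move along a line with speeds \<open>r\<close> and \<open>r'\<close>.
  The squared distance becomes a function of one variable with an interior minimum, and the
  conclusions are its first and second derivative tests.\<close>

lemma second_variation:
  fixes r r' :: real
  assumes t: "t \<in> {0..S}" and ij: "i < n" "j < n" and xy: "x \<in> {0<..<1}" "y \<in> {0<..<1}"
    and d: "d < gap 0 ((i, x), (j, y))"
    and min: "\<And>q. q \<in> points \<times> points \<Longrightarrow> d < gap 0 q \<Longrightarrow> gap t ((i, x), (j, y)) \<le> gap t q"
  defines "D \<equiv> \<gamma> i t x - \<gamma> j t y"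
    and "w \<equiv> r *\<^sub>R dx (\<gamma> i t) x - r' *\<^sub>R dx (\<gamma> j t) y"
  shows "D \<bullet> w = 0"
    and "0 \<le> w \<bullet> w + D \<bullet> (r\<^sup>2 *\<^sub>R dx (dx (\<gamma> i t)) x - r'\<^sup>2 *\<^sub>R dx (dx (\<gamma> j t)) y)"
proof -
  interpret I: flow_curve S "\<gamma> i" "V i" "b i" "B i" using edge_flow ij(1) .
  interpret J: flow_curve S "\<gamma> j" "V j" "b j" "B j" using edge_flow ij(2) .
  have zero: "0 \<in> {0..S}" using S_pos by simp
  have "((\<lambda>s. x + r * s) \<longlongrightarrow> x + r * 0) (nhds 0)" "((\<lambda>s. y + r' * s) \<longlongrightarrow> y + r' * 0) (nhds 0)"
    by (intro tendsto_intros filterlim_ident)+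
  then have "\<forall>\<^sub>F s in nhds 0. x + r * s \<in> {0<..<1}" "\<forall>\<^sub>F s in nhds 0. y + r' * s \<in> {0<..<1}"
    using xy by (auto dest!: topological_tendstoD[OF _ open_greaterThanLessThan[of 0 1]])
  then have "\<forall>\<^sub>F s in nhds 0. x + r * s \<in> {0<..<1} \<and> y + r' * s \<in> {0<..<1}"
    by (rule eventually_conj)
  then obtain h0 where h0: "0 < h0" "\<And>s. dist s 0 < h0 \<Longrightarrow> x + r * s \<in> {0<..<1} \<and> y + r' * s \<in> {0<..<1}"
    unfolding eventually_nhds_metric by blast
  define h where "h = h0 / 2"
  have h: "0 < h" and line: "\<And>s. s \<in> {- h..h} \<Longrightarrow> x + r * s \<in> {0<..<1}" "\<And>s. s \<in> {- h..h} \<Longrightarrow> y + r' * s \<in> {0<..<1}"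
    using h0 by (auto simp: h_def dist_real_def)
  define F where "F t s = \<gamma> i t (x + r * s) - \<gamma> j t (y + r' * s)" for t s
  define F' where "F' s = r *\<^sub>R dx (\<gamma> i t) (x + r * s) - r' *\<^sub>R dx (\<gamma> j t) (y + r' * s)" for s
  define F'' where "F'' = r *\<^sub>R (r *\<^sub>R dx (dx (\<gamma> i t)) x) - r' *\<^sub>R (r' *\<^sub>R dx (dx (\<gamma> j t)) y)"
  have F: "(F t has_vector_derivative F' s) (at s within {- h..h})" if "s \<in> {- h..h}" for s
    unfolding F_def F'_def
    by (intro has_vector_derivative_diff I.line_derivatives J.line_derivatives t line that)
  have h0_in: "0 \<in> {- h..h}" using h by simp
  have F': "(F' has_vector_derivative F'') (at 0 within {- h..h})"
  proof -
    have "((\<lambda>s. dx (\<gamma> i t) (x + r * s)) has_vector_derivative r *\<^sub>R dx (dx (\<gamma> i t)) x) (at 0 within {- h..h})"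
      "((\<lambda>s. dx (\<gamma> j t) (y + r' * s)) has_vector_derivative r' *\<^sub>R dx (dx (\<gamma> j t)) y) (at 0 within {- h..h})"
      using I.line_derivatives(2)[OF t line(1)[OF h0_in], of "{- h..h}"]
        J.line_derivatives(2)[OF t line(2)[OF h0_in], of "{- h..h}"] by simp_all
    then show ?thesis
      unfolding F'_def F''_def
      by (intro has_vector_derivative_diff bounded_linear.has_vector_derivative[OF bounded_linear_scaleR_right])
  qed
  have at0: "F t 0 = D" "F' 0 = w" by (simp_all add: F_def F'_def D_def w_def)
  \<comment> \<open>The varied pairs compete in the minimum because their initial gap stays above
    \<open>d\<close>, by continuity at time 0.\<close>
  have ev: "\<forall>\<^sub>F s in at 0 within {- h..h}. (norm (F t 0))\<^sup>2 \<le> (norm (F t s))\<^sup>2"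
  proof -
    have "(F 0 has_vector_derivative
        r *\<^sub>R dx (\<gamma> i 0) (x + r * 0) - r' *\<^sub>R dx (\<gamma> j 0) (y + r' * 0)) (at 0 within {- h..h})"
      unfolding F_def
      by (intro has_vector_derivative_diff I.line_derivatives J.line_derivatives zero line h0_in)
    then have "continuous (at 0 within {- h..h}) (F 0)" by (rule has_vector_derivative_continuous)
    then have "((\<lambda>s. (norm (F 0 s))\<^sup>2) \<longlongrightarrow> (norm (F 0 0))\<^sup>2) (at 0 within {- h..h})"
      unfolding continuous_within by (intro tendsto_intros)
    moreover have "d < (norm (F 0 0))\<^sup>2" using d by (simp add: F_def)
    ultimately have "\<forall>\<^sub>F s in at 0 within {- h..h}. d < (norm (F 0 s))\<^sup>2" by (rule order_tendstoD(1))
    moreover have "\<forall>\<^sub>F s in at 0 within {- h..h}. s \<in> {- h..h}" by (simp add: eventually_at_filter)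
    ultimately show ?thesis
    proof eventually_elim
      case (elim s)
      have "gap t ((i, x), (j, y)) \<le> gap t ((i, x + r * s), (j, y + r' * s))"
        by (rule min) (use elim line[OF elim(2)] ij in \<open>auto simp: points_def F_def\<close>)
      then show ?case by (simp add: F_def)
    qed
  qed
  have phi: "((\<lambda>s. (norm (F t s))\<^sup>2) has_real_derivative 2 * (F t s \<bullet> F' s)) (at s within {- h..h})"
    if "s \<in> {- h..h}" for s
    by (rule has_real_derivative_norm_sq[OF F[OF that]])
  have crit: "2 * (F t 0 \<bullet> F' 0) = 0"
    using local_min_deriv_nonneg[OF phi[OF h0_in] ev] local_min_deriv_nonpos[OF phi[OF h0_in] ev] h by auto
  then show "D \<bullet> w = 0" by (simp add: at0)
  have phi': "((\<lambda>s. 2 * (F t s \<bullet> F' s)) has_real_derivative 2 * (F t 0 \<bullet> F'' + F' 0 \<bullet> F' 0)) (at 0 within {- h..h})"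
    by (intro DERIV_cmult has_real_derivative_inner F F' h0_in)
  have "0 \<le> 2 * (F t 0 \<bullet> F'' + F' 0 \<bullet> F' 0)"
    by (rule local_min_second_deriv_nonneg[OF phi phi' crit ev h0_in]) (use h in auto)
  then show "0 \<le> w \<bullet> w + D \<bullet> (r\<^sup>2 *\<^sub>R dx (dx (\<gamma> i t)) x - r'\<^sup>2 *\<^sub>R dx (dx (\<gamma> j t)) y)"
    by (simp add: at0 F''_def power2_eq_square add.commute)
qed

text \<open>Varying one point at a time shows both tangents orthogonal to the connecting vector,
  hence parallel. Tangential velocities then do not contribute, and the relative velocity pairs with
  \<open>D\<close> exactly as the second variation does.\<close>

lemma interior_minimum_grows:
  assumes t: "t \<in> {0<..S}" and ij: "i < n" "j < n" and xy: "x \<in> {0<..<1}" "y \<in> {0<..<1}"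
    and d: "d < gap 0 ((i, x), (j, y))"
    and min: "\<And>q. q \<in> points \<times> points \<Longrightarrow> d < gap 0 q \<Longrightarrow> gap t ((i, x), (j, y)) \<le> gap t q"
    and ne: "\<gamma> i t x \<noteq> \<gamma> j t y"
  shows "0 \<le> (\<gamma> i t x - \<gamma> j t y) \<bullet> (V i t x - V j t y)"
proof -
  interpret I: flow_curve S "\<gamma> i" "V i" "b i" "B i" using edge_flow ij(1) .
  interpret J: flow_curve S "\<gamma> j" "V j" "b j" "B j" using edge_flow ij(2) .
  define D u v where "D = \<gamma> i t x - \<gamma> j t y" and "u = dx (\<gamma> i t) x" and "v = dx (\<gamma> j t) y"
  have t': "t \<in> {0..S}" and x: "x \<in> {0..1}" and y: "y \<in> {0..1}" using t xy by auto
  have D: "D \<noteq> 0" using ne by (simp add: D_def)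
  have nz: "u \<noteq> 0" "v \<noteq> 0" using I.immersed[OF t' x] J.immersed[OF t' y] by (simp_all add: u_def v_def)
  note var = second_variation[OF t' ij xy d min, folded D_def u_def v_def]
  have perp: "D \<bullet> u = 0" "D \<bullet> v = 0"
    using var(1)[of 1 0] var(1)[of 0 "1"] by simp_all
  \<comment> \<open>Moving both points with unit speed in the same direction annihilates the first-order part of
    the second variation.\<close>
  define c where "c = (if u /\<^sub>R norm u = v /\<^sub>R norm v then 1 else - 1 :: real)"
  have "u /\<^sub>R norm u = v /\<^sub>R norm v \<or> u /\<^sub>R norm u = - (v /\<^sub>R norm v)"
    by (rule unit_vectors_orthogonal_to_same[OF _ _ D]) (use nz perp in \<open>simp_all add: inner_commute\<close>)
  then have parallel: "(1 / norm u) *\<^sub>R u - (c / norm v) *\<^sub>R v = 0"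
    by (auto simp: c_def divide_inverse)
  have c2: "c\<^sup>2 = 1" by (simp add: c_def)
  have "0 \<le> D \<bullet> ((1 / norm u)\<^sup>2 *\<^sub>R dx (dx (\<gamma> i t)) x - (c / norm v)\<^sup>2 *\<^sub>R dx (dx (\<gamma> j t)) y)"
    using var(2)[of "1 / norm u" "c / norm v"] unfolding parallel by simp
  also have "\<dots> = D \<bullet> (V i t x - V j t y)"
    using I.flow[OF t x] J.flow[OF t y] perp
    by (simp add: u_def v_def power_divide c2 inner_diff_right inner_add_right)
  finally show ?thesis by (simp add: D_def)
qed

text \<open>Comparison with earlier times makes the time derivative of the gap at most
  \<open>- eps\<close>, whereas minimality in space makes it nonnegative.\<close>

lemma gap_minimum_impossible:
  assumes t: "t \<in> {0<..S}" and p: "p \<in> points \<times> points"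
    and bd: "fst p \<notin> boundary_ends" "snd p \<notin> boundary_ends"
    and eps: "0 < eps" and d: "d < gap 0 p"
    and min: "\<And>q. q \<in> points \<times> points \<Longrightarrow> d < gap 0 q \<Longrightarrow> gap t p \<le> gap t q"
    and time: "\<And>s. s \<in> {0..t} \<Longrightarrow> gap t p + eps * t \<le> gap s p + eps * s"
  shows False
proof -
  obtain i x j y where p_eq: "p = ((i, x), (j, y))" by (metis prod.collapse)
  have pts: "(i, x) \<in> points" "(j, y) \<in> points" using p by (auto simp: p_eq)
  then have ij: "i < n" "j < n" and xy: "x \<in> {0..1}" "y \<in> {0..1}" by (auto simp: points_def)
  have t': "t \<in> {0..S}" using t by simp
  define D where "D = \<gamma> i t x - \<gamma> j t y"
  have "0 \<le> D \<bullet> (V i t x - V j t y)"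
  \<comment> \<open>Where the points coincide the squared distance has zero derivative; variations
    are used for distinct points only.\<close>
  proof (cases "D = 0")
    case False
    then have ne: "\<gamma> i t x \<noteq> \<gamma> j t y" by (simp add: D_def)
    have x: "x \<in> {0<..<1}"
      by (rule end_not_minimal[OF t' pts(1) _ pts(2) d[unfolded p_eq] min[unfolded p_eq] ne])
         (use bd p_eq in auto)
    have "y \<in> {0<..<1}"
    proof (rule end_not_minimal[OF t' pts(2) _ pts(1), of d])
      show "d < gap 0 ((j, y), (i, x))" using d by (simp add: p_eq norm_minus_commute)
      show "gap t ((j, y), (i, x)) \<le> gap t q" if "q \<in> points \<times> points" "d < gap 0 q" for q
        using min[of "(snd q, fst q)"] that gap_swap[of _ "fst q" "snd q"]
          gap_swap[of t "(j, y)" "(i, x)"] by (auto simp del: gap_eq simp: p_eq)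
    qed (use bd p_eq ne in auto)
    from interior_minimum_grows[OF t ij x this d[unfolded p_eq] min[unfolded p_eq] ne]
    show ?thesis by (simp add: D_def)
  qed simp
  moreover have "2 * (D \<bullet> (V i t x - V j t y)) + eps \<le> 0"
  proof (rule local_min_deriv_nonpos)
    have "((\<lambda>s. \<gamma> i s x - \<gamma> j s y) has_vector_derivative V i t x - V j t y) (at t within {0..S})"
      by (intro has_vector_derivative_diff flow_curve.dtu[OF edge_flow] ij t' xy)
    then have "((\<lambda>s. \<gamma> i s x - \<gamma> j s y) has_vector_derivative V i t x - V j t y) (at t within {0..t})"
      by (rule has_vector_derivative_within_subset) (use t in auto)
    from has_real_derivative_norm_sq[OF this]
    show "((\<lambda>s. gap s p + eps * s) has_real_derivative 2 * (D \<bullet> (V i t x - V j t y)) + eps) (at t within {0..t})"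
      unfolding p_eq gap_eq D_def by (rule DERIV_add) (auto intro!: derivative_eq_intros)
    show "\<forall>\<^sub>F s in at t within {0..t}. gap t p + eps * t \<le> gap s p + eps * s"
      using time by (simp add: eventually_at_filter)
  qed (use t in auto)
  ultimately show False using eps by simp
qed

section \<open>Isolation and persistence of coincidences\<close>

text \<open>At parameter 1 moving away from the vertex means decreasing the parameter; the sign
  \<open>c\<close> reduces this case to \<open>locally_monotone\<close>.\<close>

lemma end_monotone:
  assumes t: "t \<in> {0..S}" and ix: "(i, x) \<in> ends_at n \<sigma> p" and pos: "0 < tangent t (i, x) \<bullet> w"
  obtains d where "0 < d"
    "\<And>s y. s \<in> {0..S} \<Longrightarrow> y \<in> {0..1} \<Longrightarrow> \<bar>s - t\<bar> < d \<Longrightarrow> \<bar>y - x\<bar> < d \<Longrightarrow> y \<noteq> x \<Longrightarrow>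
      \<gamma> i s x \<bullet> w < \<gamma> i s y \<bullet> w"
proof -
  have i: "i < n" "x \<in> {0, 1}" "x \<in> {0..1}" using ix by (auto simp: mem_ends_at)
  interpret flow_curve S "\<gamma> i" "V i" "b i" "B i" using edge_flow i(1) .
  define c :: real where "c = (if x = 0 then 1 else - 1)"
  have "0 < dx (\<gamma> i t) x \<bullet> (c *\<^sub>R w)"
    using pos tangent_inner(1)[OF t ix] by (auto simp: c_def)
  from locally_monotone[OF t i(3) this] obtain d where d: "0 < d"
    "\<And>s y z. s \<in> {0..S} \<Longrightarrow> y \<in> {0..1} \<Longrightarrow> z \<in> {0..1} \<Longrightarrow> \<bar>s - t\<bar> < d \<Longrightarrow> \<bar>y - x\<bar> < d \<Longrightarrow>
      \<bar>z - x\<bar> < d \<Longrightarrow> y < z \<Longrightarrow> \<gamma> i s y \<bullet> (c *\<^sub>R w) < \<gamma> i s z \<bullet> (c *\<^sub>R w)"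
    by blast
  show thesis
  proof (rule that[OF d(1)])
    fix s y assume *: "s \<in> {0..S}" "y \<in> {0..1}" "\<bar>s - t\<bar> < d" "\<bar>y - x\<bar> < d" "y \<noteq> x"
    show "\<gamma> i s x \<bullet> w < \<gamma> i s y \<bullet> w"
      using d(2)[of s x y] d(2)[of s y x] * d(1) i by (auto simp: c_def)
  qed
qed

text \<open>Near a diagonal pair the immersion makes the edge injective. Off the diagonal,
  embeddedness of the initial network puts the pair at a junction, where the distinct tangents at
  time \<open>t\<close> separate the two edges by a line, uniformly for nearby times.\<close>

lemma gap_zero_isolated:
  assumes t: "t \<in> {0..S}" and p: "p \<in> points \<times> points" and zero: "gap 0 p = 0"
  shows "\<forall>\<^sub>F z in at (t, p) within {0..S} \<times> (points \<times> points).
    (case z of (s, q) \<Rightarrow> gap s q = 0 \<longrightarrow> gap 0 q = 0)"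
proof -
  obtain i x j y where p_eq: "p = ((i, x), (j, y))" by (metis prod.collapse)
  have ij: "i < n" "j < n" and xy: "x \<in> {0..1}" "y \<in> {0..1}" using p by (auto simp: p_eq points_def)
  have meet: "\<sigma> i x = \<sigma> j y" using zero initial[OF ij(1) xy(1)] initial[OF ij(2) xy(2)] by (simp add: p_eq)
  obtain d where d: "0 < d" and iso: "\<And>s x' y'. \<lbrakk>s \<in> {0..S}; x' \<in> {0..1}; y' \<in> {0..1}; \<bar>s - t\<bar> < d;
      \<bar>x' - x\<bar> < d; \<bar>y' - y\<bar> < d; \<gamma> i s x' = \<gamma> j s y'\<rbrakk> \<Longrightarrow> \<gamma> i 0 x' = \<gamma> j 0 y'"
  proof (cases "(i, x) = (j, y)")
    case True
    interpret flow_curve S "\<gamma> i" "V i" "b i" "B i" using edge_flow ij(1) .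
    have "0 < dx (\<gamma> i t) x \<bullet> dx (\<gamma> i t) x" using immersed[OF t xy(1)] by simp
    from locally_monotone[OF t xy(1) this] obtain d where d: "0 < d"
      "\<And>s y z. s \<in> {0..S} \<Longrightarrow> y \<in> {0..1} \<Longrightarrow> z \<in> {0..1} \<Longrightarrow> \<bar>s - t\<bar> < d \<Longrightarrow> \<bar>y - x\<bar> < d \<Longrightarrow>
        \<bar>z - x\<bar> < d \<Longrightarrow> y < z \<Longrightarrow> \<gamma> i s y \<bullet> dx (\<gamma> i t) x < \<gamma> i s z \<bullet> dx (\<gamma> i t) x"
      by blast
    show thesis
    proof (rule that[OF d(1)])
      fix s x' y' assume *: "s \<in> {0..S}" "x' \<in> {0..1}" "y' \<in> {0..1}" "\<bar>s - t\<bar> < d"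
        "\<bar>x' - x\<bar> < d" "\<bar>y' - y\<bar> < d" "\<gamma> i s x' = \<gamma> j s y'"
      have "x' = y'"
        using d(2)[of s x' y'] d(2)[of s y' x'] * True by (cases x' y' rule: linorder_cases) auto
      then show "\<gamma> i 0 x' = \<gamma> j 0 y'" using True by simp
    qed
  next
    case False
    define q where "q = \<sigma> i x"
    have "embedded n \<sigma>" using is_network by (simp add: network_def)
    then have "x \<in> {0, 1}" "y \<in> {0, 1}"
      using False meet ij xy unfolding embedded_def by (metis prod.inject)+
    then have ends: "(i, x) \<in> ends_at n \<sigma> q" "(j, y) \<in> ends_at n \<sigma> q"
      using ij meet by (auto simp: q_def mem_ends_at)
    \<comment> \<open>A fixed end-point carries a single curve end, so two distinct ends can only
      meet at a multi-point.\<close>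
    have "(i, x) \<notin> boundary_ends"
      using boundary_endsD(5)[of i x] ends False by (auto simp: q_def)
    then have q: "q \<in> multi_points n \<sigma>"
      using end_cases[OF ij(1) \<open>x \<in> {0, 1}\<close>] by (simp add: q_def)
    define u v where "u = tangent t (i, x)" and "v = tangent t (j, y)"
    have unit: "u \<bullet> u = 1" "v \<bullet> v = 1"
      using norm_tangent[OF t ends(1)] norm_tangent[OF t ends(2)] by (simp_all add: u_def v_def norm_eq_1)
    have "inj_on (tangent t) (ends_at n \<sigma> q)"
      by (rule three_unit_vectors_sum_zero(1)[OF card_ends[OF q] norm_tangent[OF t] balance[OF t q]])
    then have "u \<noteq> v" using inj_onD ends False unfolding u_def v_def by metis
    \<comment> \<open>The products of \<open>u\<close> and \<open>v\<close> with
      \<open>u - v\<close> are opposite nonzero numbers, so the two edges leave the junction on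
      opposite sides of the line orthogonal to \<open>u - v\<close>.\<close>
    then have "0 < (u - v) \<bullet> (u - v)" by simp
    then have "0 < 2 * (1 - u \<bullet> v)"
      using unit by (simp add: inner_diff inner_commute)
    then have "0 < u \<bullet> (u - v)" "0 < v \<bullet> (v - u)"
      using unit by (simp_all add: inner_diff_right inner_commute)
    obtain d1 where d1: "0 < d1" "\<And>s z. s \<in> {0..S} \<Longrightarrow> z \<in> {0..1} \<Longrightarrow> \<bar>s - t\<bar> < d1 \<Longrightarrow> \<bar>z - x\<bar> < d1 \<Longrightarrow> z \<noteq> x \<Longrightarrow>
        \<gamma> i s x \<bullet> (u - v) < \<gamma> i s z \<bullet> (u - v)"
      using end_monotone[OF t ends(1)] \<open>0 < u \<bullet> (u - v)\<close> unfolding u_def by blast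
    obtain d2 where d2: "0 < d2" "\<And>s z. s \<in> {0..S} \<Longrightarrow> z \<in> {0..1} \<Longrightarrow> \<bar>s - t\<bar> < d2 \<Longrightarrow> \<bar>z - y\<bar> < d2 \<Longrightarrow> z \<noteq> y \<Longrightarrow>
        \<gamma> j s y \<bullet> (v - u) < \<gamma> j s z \<bullet> (v - u)"
      using end_monotone[OF t ends(2)] \<open>0 < v \<bullet> (v - u)\<close> unfolding v_def by blast
    show thesis
    proof (rule that[of "min d1 d2"])
      fix s x' y' assume *: "s \<in> {0..S}" "x' \<in> {0..1}" "y' \<in> {0..1}" "\<bar>s - t\<bar> < min d1 d2"
        "\<bar>x' - x\<bar> < min d1 d2" "\<bar>y' - y\<bar> < min d1 d2" "\<gamma> i s x' = \<gamma> j s y'"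
      have same: "\<gamma> i s x = \<gamma> j s y" by (rule concur[OF *(1) q ends])
      have 1: "\<gamma> i s x \<bullet> (u - v) \<le> \<gamma> i s x' \<bullet> (u - v)" "x' \<noteq> x \<Longrightarrow> \<gamma> i s x \<bullet> (u - v) < \<gamma> i s x' \<bullet> (u - v)"
        using d1(2)[of s x'] * by (cases "x' = x"; force)+
      have 2: "\<gamma> j s y \<bullet> (v - u) \<le> \<gamma> j s y' \<bullet> (v - u)" "y' \<noteq> y \<Longrightarrow> \<gamma> j s y \<bullet> (v - u) < \<gamma> j s y' \<bullet> (v - u)"
        using d2(2)[of s y'] * by (cases "y' = y"; force)+
      have "x' = x" "y' = y"
        using 1 2 same *(7) by (auto simp: inner_diff_right)
      then show "\<gamma> i 0 x' = \<gamma> j 0 y'"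
        using concur[OF _ q ends, of 0] S_pos by simp
    qed (use d1 d2 in auto)
  qed
  \<comment> \<open>Edge indices are discrete, so a neighbourhood of the pair can keep both edges
    fixed.\<close>
  define W where "W = {t - d<..<t + d} \<times> (({i} \<times> {x - d<..<x + d}) \<times> ({j} \<times> {y - d<..<y + d}))"
  have "open W" unfolding W_def by (intro open_Times open_discrete) auto
  moreover have "(t, p) \<in> W" using d by (simp add: W_def p_eq)
  moreover have "case z of (s, q) \<Rightarrow> gap s q = 0 \<longrightarrow> gap 0 q = 0"
    if z: "z \<in> W" "z \<in> {0..S} \<times> (points \<times> points)" for z
  proof -
    obtain s x' y' where z_eq: "z = (s, (i, x'), (j, y'))"
      and "\<bar>s - t\<bar> < d" "\<bar>x' - x\<bar> < d" "\<bar>y' - y\<bar> < d"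
      using z(1) by (auto simp: W_def abs_less_iff)
    then show ?thesis using iso[of s x' y'] z(2) by (auto simp: points_def)
  qed
  ultimately show ?thesis unfolding eventually_at_topological by blast
qed

text \<open>This is \<open>zeros_stay_initial\<close> for \<open>gap\<close> on pairs of parameters,
  with the pairs containing a fixed end-point as the exceptional set.\<close>

lemma coincidences_initial:
  assumes t: "t \<in> {0..S}" and p: "(i, x) \<in> points" "(j, y) \<in> points" and meet: "\<gamma> i t x = \<gamma> j t y"
  shows "\<sigma> i x = \<sigma> j y"
proof -
  have initial': "\<gamma> k 0 z = \<sigma> k z" if "(k, z) \<in> points" for k z
    using that initial by (auto simp: points_def)
  \<comment> \<open>A point that meets a fixed end-point lies on the frontier, hence is a fixed
    end-point itself, and neither of the two has moved.\<close>
  have stuck: "\<sigma> k z = \<sigma> l v"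
    if s: "s \<in> {0..S}" and kz: "(k, z) \<in> boundary_ends" and lv: "(l, v) \<in> points" "\<gamma> k s z = \<gamma> l s v"
    for s k z l v
  proof -
    have k: "\<gamma> k s z = \<sigma> k z" "\<sigma> k z \<in> frontier \<Omega>"
      using boundary_endsD(6)[OF kz s] boundary_endsD(4)[OF kz] by auto
    then have "(l, v) \<in> boundary_ends" using frontier_imp_boundary_end[OF s lv(1)] lv(2) by simp
    then show ?thesis using boundary_endsD(6)[OF _ s] k lv(2) by metis
  qed
  have "finite boundary_ends"
    by (rule finite_subset[OF _ finite_curve_ends]) (auto simp: boundary_ends_def)
  then have closed: "closed (boundary_ends \<times> UNIV \<union> UNIV \<times> boundary_ends)"
    by (simp add: closed_Un closed_Times finite_imp_closed)
  have "gap 0 ((i, x), (j, y)) = 0"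
  proof (rule zeros_stay_initial[OF S_pos _ continuous_gap _ _ closed, of t])
    show "compact (points \<times> points)" by (intro compact_Times compact_points)
    show "0 \<le> gap s q" for s q by (cases q) (auto simp: gap_def)
    show "\<forall>\<^sub>F z in at (s, q) within {0..S} \<times> (points \<times> points).
        (case z of (s, q) \<Rightarrow> gap s q = 0 \<longrightarrow> gap 0 q = 0)"
      if "s \<in> {0..S}" "q \<in> points \<times> points" "gap 0 q = 0" for s q
      using gap_zero_isolated[OF that] .
    show "gap 0 q = 0"
      if q: "s \<in> {0..S}" "q \<in> points \<times> points" "q \<in> boundary_ends \<times> UNIV \<union> UNIV \<times> boundary_ends" "gap s q = 0"
      for s q
    proof -
      obtain k z l v where q_eq: "q = ((k, z), (l, v))" by (metis prod.collapse)
      have "\<sigma> k z = \<sigma> l v"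
        using stuck[of s k z l v] stuck[of s l v k z] q by (auto simp: q_eq)
      then show ?thesis using initial' q(2) by (simp add: q_eq)
    qed
    show False if "s \<in> {0<..S}" "q \<in> points \<times> points" "q \<notin> boundary_ends \<times> UNIV \<union> UNIV \<times> boundary_ends"
      "0 < eps" "d < gap 0 q" "\<And>q'. q' \<in> points \<times> points \<Longrightarrow> d < gap 0 q' \<Longrightarrow> gap s q \<le> gap s q'"
      "\<And>s'. s' \<in> {0..s} \<Longrightarrow> gap s q + eps * s \<le> gap s' q + eps * s'" for s q eps d
      using gap_minimum_impossible[OF that(1,2) _ _ that(4-7)] that(3) by (cases q) auto
  qed (use t p meet in auto)
  then show ?thesis using initial' p by simp
qed

lemma stays_embedded:
  assumes t: "t \<in> {0..S}"
  shows "embedded n (\<lambda>i. \<gamma> i t)"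
proof -
  have "\<sigma> i x = \<sigma> j y" if "i < n" "j < n" "x \<in> {0..1}" "y \<in> {0..1}" "\<gamma> i t x = \<gamma> j t y" for i j x y
    by (rule coincidences_initial[OF t _ _ that(5)]) (use that in \<open>auto simp: points_def\<close>)
  moreover have "embedded n \<sigma>" using is_network by (simp add: network_def)
  ultimately show ?thesis unfolding embedded_def by blast
qed

text \<open>The ends at a vertex are counted afresh from the positions at time \<open>t\<close>. A
  second end at the same place would have coincided with the first initially, which the initial
  network excludes on the frontier.\<close>

lemma meets_frontier_at_end_points:
  assumes t: "t \<in> {0..S}"
  shows "network_set n (\<lambda>i. \<gamma> i t) \<inter> frontier \<Omega> \<subseteq> end_points n (\<lambda>i. \<gamma> i t)"
proof
  fix q assume q: "q \<in> network_set n (\<lambda>i. \<gamma> i t) \<inter> frontier \<Omega>"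
  then obtain i x where ix: "(i, x) \<in> points" "\<gamma> i t x = q"
    by (auto simp: network_set_def points_def)
  then have bd: "(i, x) \<in> boundary_ends" using frontier_imp_boundary_end[OF t] q by auto
  have fixed: "\<gamma> i t x = \<sigma> i x" by (rule boundary_endsD(6)[OF bd t])
  have "ends_at n (\<lambda>i. \<gamma> i t) q = {(i, x)}"
  proof (intro equalityI subsetI)
    fix e assume e: "e \<in> ends_at n (\<lambda>i. \<gamma> i t) q"
    obtain j y where e_eq: "e = (j, y)" by force
    have jy: "j < n" "y \<in> {0, 1}" "\<gamma> j t y = q" using e by (auto simp: e_eq ends_at_def curve_ends_def)
    then have "\<sigma> j y = \<sigma> i x"
      using coincidences_initial[OF t _ ix(1), of j y] ix(2) by (auto simp: points_def)
    then have "(j, y) \<in> ends_at n \<sigma> (\<sigma> i x)" using jy by (simp add: mem_ends_at)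
    then show "e \<in> {(i, x)}" using boundary_endsD(5)[OF bd] by (simp add: e_eq)
  qed (use boundary_endsD(1,2)[OF bd] ix(2) in \<open>auto simp: ends_at_def curve_ends_def\<close>)
  then show "q \<in> end_points n (\<lambda>i. \<gamma> i t)" by (simp add: end_points_def)
qed

end

section \<open>Transversality\<close>

text \<open>Transversality asks the edge tangent and the tangent space to span the plane, so a
  nonzero frontier tangent is required. It is the velocity of the graph of \<open>g\<close> in the
  chart at \<open>p\<close>.\<close>

lemma smooth_boundary_tangent:
  assumes "open \<Omega>" "smooth_boundary \<Omega>" "p \<in> frontier \<Omega>"
  obtains v where "v \<in> tangent_space (frontier \<Omega>) p" "v \<noteq> 0"
proof -
  obtain r e g where r: "0 < r" and e: "norm e = 1" and g: "smooth_function g"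
    and chart: "\<And>q. q \<in> ball p r \<Longrightarrow> q \<in> \<Omega> \<longleftrightarrow> g (q \<bullet> e) < q \<bullet> rot90 e"
    using assms(2,3) unfolding smooth_boundary_def by metis
  have "((deriv ^^ 0) g) differentiable_on UNIV" using g unfolding smooth_function_def by blast
  then have diff: "g differentiable (at x)" for x by (simp add: differentiable_on_def)
  then have contg: "isCont g x" for x by (simp add: differentiable_imp_continuous_within)
  define f where "f = rot90 e"
  have basis: "e \<bullet> e = 1" "f \<bullet> f = 1" "e \<bullet> f = 0" "f \<bullet> e = 0"
  proof -
    show "e \<bullet> e = 1" using e by (simp add: norm_eq_1)
    have "norm f = 1" using e by (simp add: f_def)
    then show "f \<bullet> f = 1" by (simp add: norm_eq_1)
    show "e \<bullet> f = 0" by (simp add: f_def)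
    then show "f \<bullet> e = 0" by (simp add: inner_commute)
  qed
  have decomp: "q = (q \<bullet> e) *\<^sub>R e + (q \<bullet> f) *\<^sub>R f" for q
    using plane_decompose[of e q] e by (force simp: f_def)
  define c where "c s = (p \<bullet> e + s) *\<^sub>R e + g (p \<bullet> e + s) *\<^sub>R f" for s
  have coords: "c s \<bullet> e = p \<bullet> e + s" "c s \<bullet> f = g (p \<bullet> e + s)" for s
    by (simp_all add: c_def inner_add_left basis)
  \<comment> \<open>Points of the graph are outside the strict epigraph but are limits of the points
    just above them.\<close>
  have on_graph: "q \<in> frontier \<Omega>" if q: "q \<in> ball p r" "g (q \<bullet> e) = q \<bullet> f" for q
  proof -
    have "q \<notin> \<Omega>" using chart[OF q(1)] q(2) by (simp add: f_def)
    moreover have "q \<in> closure \<Omega>"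
    proof -
      have "((\<lambda>h. q + h *\<^sub>R f) \<longlongrightarrow> q + 0 *\<^sub>R f) (at_right 0)"
        by (intro tendsto_intros)
      moreover from this have "\<forall>\<^sub>F h in at_right 0. q + h *\<^sub>R f \<in> ball p r"
        using topological_tendstoD[OF _ open_ball] q(1) by fastforce
      then have "\<forall>\<^sub>F h in at_right 0. q + h *\<^sub>R f \<in> \<Omega>"
        using eventually_at_right_less[of "0::real"]
      proof eventually_elim
        case (elim h)
        have "g ((q + h *\<^sub>R f) \<bullet> e) < (q + h *\<^sub>R f) \<bullet> f"
          using elim(2) q(2) by (simp add: inner_add_left basis)
        then show ?case using chart[OF elim(1)] by (simp add: f_def)
      qed
      then have "\<forall>\<^sub>F h in at_right 0. q + h *\<^sub>R f \<in> closure \<Omega>"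
        by (rule eventually_mono) (use closure_subset in auto)
      ultimately have "q + 0 *\<^sub>R f \<in> closure \<Omega>"
        by (intro Lim_in_closed_set[OF closed_closure _ trivial_limit_at_right_real])
      then show ?thesis by simp
    qed
    ultimately show ?thesis using assms(1) by (simp add: frontier_def interior_open)
  qed
  \<comment> \<open>One inequality holds because \<open>p\<close> is outside the open set. If
    \<open>p\<close> were strictly below the graph, a whole neighbourhood would miss the
    domain.\<close>
  have graph_p: "g (p \<bullet> e) = p \<bullet> f"
  proof (rule antisym)
    have p: "p \<in> closure \<Omega>" "p \<notin> \<Omega>" using assms(1,3) by (auto simp: frontier_def interior_open)
    show "p \<bullet> f \<le> g (p \<bullet> e)" using chart[of p] p(2) r by (auto simp: f_def)
    show "g (p \<bullet> e) \<le> p \<bullet> f"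
    proof (rule ccontr)
      assume "\<not> g (p \<bullet> e) \<le> p \<bullet> f"
      then have pos: "0 < g (p \<bullet> e) - p \<bullet> f" by simp
      have "isCont (\<lambda>q. g (q \<bullet> e) - q \<bullet> f) p"
        by (intro continuous_intros isCont_o2[OF _ contg])
      then have "((\<lambda>q. g (q \<bullet> e) - q \<bullet> f) \<longlongrightarrow> g (p \<bullet> e) - p \<bullet> f) (nhds p)"
        by (simp add: continuous_at tendsto_nhds_iff)
      then have "\<forall>\<^sub>F q in nhds p. 0 < g (q \<bullet> e) - q \<bullet> f" using pos by (rule order_tendstoD(1))
      moreover have "\<forall>\<^sub>F q in nhds p. q \<in> ball p r"
        using r by (intro eventually_nhds_in_open) auto
      ultimately have "\<forall>\<^sub>F q in nhds p. q \<notin> \<Omega>"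
        by eventually_elim (use chart in \<open>auto simp: f_def\<close>)
      then obtain U where "open U" "p \<in> U" "U \<inter> \<Omega> = {}" by (auto simp: eventually_nhds)
      then show False using p(1) by (metis IntI disjoint_iff open_Int_closure_eq_empty)
    qed
  qed
  have c0: "c 0 = p" using decomp[of p] graph_p by (simp add: c_def)
  define v where "v = e + deriv g (p \<bullet> e) *\<^sub>R f"
  have dg: "(g has_real_derivative deriv g (p \<bullet> e)) (at (p \<bullet> e + 0))"
    using diff[of "p \<bullet> e"] by (simp add: DERIV_deriv_iff_real_differentiable)
  have "((\<lambda>s. g (p \<bullet> e + s)) has_real_derivative deriv g (p \<bullet> e) * 1) (at 0)"
    by (rule DERIV_chain2[where g = "\<lambda>s. p \<bullet> e + s", OF dg]) (auto intro!: derivative_eq_intros)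
  then have gder: "((\<lambda>s. g (p \<bullet> e + s)) has_vector_derivative deriv g (p \<bullet> e)) (at 0)"
    by (simp add: has_real_derivative_iff_has_vector_derivative)
  have "((\<lambda>s. p \<bullet> e + s) has_vector_derivative 1) (at 0)"
    by (auto intro!: derivative_eq_intros)
  from has_vector_derivative_add[OF
      bounded_linear.has_vector_derivative[OF bounded_linear_scaleR_left this, of e]
      bounded_linear.has_vector_derivative[OF bounded_linear_scaleR_left gder, of f]]
  have c': "(c has_vector_derivative v) (at 0)"
    by (simp add: c_def[abs_def] v_def)
  then have "(c \<longlongrightarrow> p) (at 0)"
    using has_vector_derivative_continuous[OF c'] c0 by (simp add: continuous_at isCont_def)
  then have "(c \<longlongrightarrow> p) (nhds 0)" using c0 by (simp add: tendsto_nhds_iff)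
  then have "\<forall>\<^sub>F s in nhds 0. c s \<in> ball p r"
    by (rule topological_tendstoD) (use r in auto)
  then have "\<forall>\<^sub>F s in nhds 0. c s \<in> frontier \<Omega>"
    by eventually_elim (use on_graph coords in auto)
  then have "v \<in> tangent_space (frontier \<Omega>) p"
    using c0 c' by (auto simp: tangent_space_def)
  moreover have "v \<bullet> e = 1" by (simp add: v_def inner_add_left basis)
  then have "v \<noteq> 0" by auto
  ultimately show thesis by (rule that)
qed

text \<open>Along a curve in \<open>S\<close> the height has a minimum at the interior parameter 0,
  so its derivative vanishes there.\<close>

lemma tangent_space_supporting:
  assumes half: "\<And>z. z \<in> S \<Longrightarrow> z \<bullet> e \<le> p \<bullet> e" and v: "v \<in> tangent_space S p"
  shows "v \<bullet> e = 0"
proof -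
  obtain c where c: "c 0 = p" "\<forall>\<^sub>F s in nhds 0. c s \<in> S" "(c has_vector_derivative v) (at 0)"
    using v by (auto simp: tangent_space_def)
  have D: "((\<lambda>s. p \<bullet> e - c s \<bullet> e) has_real_derivative - (v \<bullet> e)) (at 0)"
    by (rule has_real_derivative_height[OF c(3)])
  obtain d where d: "0 < d" "\<And>s. dist s 0 < d \<Longrightarrow> c s \<in> S"
    using c(2) unfolding eventually_nhds_metric by blast
  have "- (v \<bullet> e) = 0"
    by (rule DERIV_local_min[OF D d(1)]) (use d(2) half c(1) in \<open>auto simp: dist_real_def\<close>)
  then show ?thesis by simp
qed

lemma span_independent_plane:
  fixes u v e :: plane
  assumes "v \<noteq> 0" "v \<bullet> e = 0" "u \<bullet> e \<noteq> 0"
  shows "span {u, v} = UNIV"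
proof -
  have "independent {u, v}"
  proof -
    have "u \<notin> span {v}"
      using assms(2,3) by (auto simp: span_singleton)
    then show ?thesis using assms(1) by (auto simp: independent_insert)
  qed
  moreover have "u \<noteq> v" using assms by auto
  then have "card {u, v} = DIM(plane)" by simp
  ultimately have "UNIV \<subseteq> span {u, v}"
    by (intro card_ge_dim_independent) auto
  then show ?thesis by auto
qed

text \<open>Frontier tangents are orthogonal to the supporting normal \<open>e\<close>, while the
  Hopf lemma gives the edge tangent a nonzero component along it.\<close>

lemma (in network_flow) transversal:
  assumes "smooth_boundary \<Omega>" and t: "t \<in> {0<..S}" and ix: "i < n" "x \<in> {0..1}" and front: "\<gamma> i t x \<in> frontier \<Omega>"
  shows "transversal_at (\<gamma> i t) x (frontier \<Omega>)"
proof -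
  define p where "p = \<gamma> i t x"
  have t': "t \<in> {0..S}" using t by simp
  have bd: "(i, x) \<in> boundary_ends"
    by (rule frontier_imp_boundary_end[OF t' _ front]) (use ix in \<open>simp add: points_def\<close>)
  have "p \<notin> \<Omega>" using front open_dom by (auto simp: p_def frontier_def interior_open)
  then obtain e where e: "\<And>z. z \<in> \<Omega> \<Longrightarrow> z \<bullet> e < p \<bullet> e" "\<And>z. z \<in> closure \<Omega> \<Longrightarrow> z \<bullet> e \<le> p \<bullet> e"
    using open_convex_support[OF open_dom convex_dom] by metis
  obtain v where v: "v \<in> tangent_space (frontier \<Omega>) p" "v \<noteq> 0"
    using smooth_boundary_tangent[OF open_dom assms(1)] front unfolding p_def by metis
  have "v \<bullet> e = 0"
    by (rule tangent_space_supporting[OF _ v(1)]) (use e(2) in \<open>auto simp: frontier_def\<close>)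
  moreover have ends: "(i, x) \<in> ends_at n \<sigma> (\<sigma> i x)"
    using boundary_endsD(5)[OF bd] by simp
  have "0 < tangent t (i, x) \<bullet> (- e)"
    by (rule outward_slope[OF e t ends]) (simp_all add: p_def)
  then have "dx (\<gamma> i t) x \<bullet> e \<noteq> 0"
    using tangent_inner(2)[OF t' ends, of e] by auto
  ultimately have "span {dx (\<gamma> i t) x, v} = UNIV"
    using span_independent_plane[OF v(2)] by simp
  moreover have "span {dx (\<gamma> i t) x, v} \<subseteq> span (insert (dx (\<gamma> i t) x) (tangent_space (frontier \<Omega>) p))"
    by (rule span_mono) (use v(1) in auto)
  ultimately show ?thesis by (auto simp: transversal_at_def p_def)
qed

section \<open>The curvature flow\<close>

text \<open>The parameter derivative of the unit tangent is \<open>w / |v|\<close> plus a multiple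
  of \<open>v\<close>, so the curvature vector and \<open>w / |v|^2\<close> have the same normal
  component. Hence \<open>z\<close> differs from \<open>w / |v|^2\<close> by a tangential vector,
  whose coefficient is found by projecting on \<open>v\<close>.\<close>

lemma velocity_from_normal_component:
  assumes x: "x \<in> {0..1}" and nz: "dx c x \<noteq> 0"
    and ddc: "(dx c has_vector_derivative w) (at x within {0..1})"
    and motion: "normal_component c x z = curvature_vector c x"
  defines "v \<equiv> dx c x"
  shows "z = (1 / (norm v)\<^sup>2) *\<^sub>R w + (((z - (1 / (norm v)\<^sup>2) *\<^sub>R w) \<bullet> v) / (norm v)\<^sup>2) *\<^sub>R v"
proof -
  define \<nu> where "\<nu> = unit_normal c x"
  have v: "0 < norm v" using nz by (simp add: v_def)
  have \<nu>: "\<nu> = rot90 v /\<^sub>R norm v"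
    by (simp add: \<nu>_def unit_normal_def unit_tangent_def v_def vec_eq_iff forall_2)
  have perp: "v \<bullet> \<nu> = 0" by (simp add: \<nu>)
  have "norm \<nu> = 1" using v by (simp add: \<nu>)
  then have unit: "\<nu> \<bullet> \<nu> = 1" by (simp add: norm_eq_1)
  have "(\<lambda>y. norm (dx c y)) differentiable (at x within {0..1})"
    using differentiable_compose[of norm "dx c" x "{0..1}"] differentiable_norm_at[OF nz] ddc
    by (auto simp: differentiable_def has_vector_derivative_def)
  then obtain k where k: "((\<lambda>y. norm (dx c y)) has_real_derivative k) (at x within {0..1})"
    by (auto simp: real_differentiable_def)
  \<comment> \<open>The derivative of the reciprocal speed. It multiplies \<open>v\<close>, hence
    disappears against the normal.\<close>
  define k' where "k' = - (inverse (norm v) * k * inverse (norm v))"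
  have "((\<lambda>y. inverse (norm (dx c y))) has_real_derivative k') (at x within {0..1})"
    using DERIV_inverse'[OF k] v by (simp add: k'_def v_def)
  from has_vector_derivative_scaleR[OF this ddc]
  have "(unit_tangent c has_vector_derivative inverse (norm v) *\<^sub>R w + k' *\<^sub>R v) (at x within {0..1})"
    by (simp add: unit_tangent_def[abs_def] v_def)
  then have "dx (unit_tangent c) x = inverse (norm v) *\<^sub>R w + k' *\<^sub>R v"
    unfolding dx_def using x by (intro vector_derivative_within_cbox[of 0 1, unfolded cbox_interval]) auto
  then have "curvature_vector c x \<bullet> \<nu> = (w \<bullet> \<nu>) / (norm v)\<^sup>2"
    by (simp add: curvature_vector_def inner_add_left perp power2_eq_square divide_inverse flip: v_def)
  moreover have "normal_component c x z \<bullet> \<nu> = z \<bullet> \<nu>"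
    by (simp add: normal_component_def unit flip: \<nu>_def)
  ultimately have "(z - (1 / (norm v)\<^sup>2) *\<^sub>R w) \<bullet> \<nu> = 0"
    using motion by (simp add: inner_diff_left)
  then have "(z - (1 / (norm v)\<^sup>2) *\<^sub>R w) \<bullet> rot90 v = 0"
    using v by (simp add: \<nu>)
  then have "z - (1 / (norm v)\<^sup>2) *\<^sub>R w = (((z - (1 / (norm v)\<^sup>2) *\<^sub>R w) \<bullet> v) / (norm v)\<^sup>2) *\<^sub>R v"
    using plane_decompose[of v "z - (1 / (norm v)\<^sup>2) *\<^sub>R w"] v by simp
  then show ?thesis by (simp add: algebra_simps)
qed

text \<open>The margin between \<open>S\<close> and \<open>S'\<close> makes every time in
  \<open>{0<..S}\<close> interior to \<open>{0..S'}\<close>, so the time derivatives within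
  \<open>{0..S'}\<close> and within the whole time interval agree there. Continuity on the compact
  rectangle up to \<open>S'\<close> bounds the tangential coefficient.\<close>

lemma curvature_flow_edge:
  assumes flow: "curvature_flow \<Omega> n \<sigma> \<alpha> T \<gamma>" and i: "i < n"
    and S: "0 < S" "S < S'" "ereal S' < T"
  shows "\<exists>V b B. flow_curve S (\<gamma> i) V b B"
proof -
  have S': "0 < S'" using S by simp
  have sub: "{0..S} \<subseteq> {0..S'}" using S by auto
  define V where "V = dt {0..S'} (\<gamma> i)"
  define b where "b t x = ((V t x - (1 / (norm (dx (\<gamma> i t) x))\<^sup>2) *\<^sub>R dx (dx (\<gamma> i t)) x) \<bullet> dx (\<gamma> i t) x)
      / (norm (dx (\<gamma> i t) x))\<^sup>2" for t x
  have time: "{0..S'} \<subseteq> time_interval T"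
  proof
    fix t assume t: "t \<in> {0..S'}"
    have "ereal t < T" by (rule le_less_trans[OF _ S(3)]) (use t in simp)
    then show "t \<in> time_interval T" using t by (simp add: time_interval_def)
  qed
  have "parabolic_holder \<alpha> {0..S'} (\<gamma> i)"
    using flow i S' S(3) unfolding curvature_flow_def by blast
  then have diff: "\<And>t. t \<in> {0..S'} \<Longrightarrow> \<gamma> i t differentiable_on {0..1}"
      "\<And>t. t \<in> {0..S'} \<Longrightarrow> dx (\<gamma> i t) differentiable_on {0..1}"
      "\<And>x. x \<in> {0..1} \<Longrightarrow> (\<lambda>t. \<gamma> i t x) differentiable_on {0..S'}"
    and cont: "continuous_on ({0..S'} \<times> {0..1}) (\<lambda>(t, x). \<gamma> i t x)"
      "continuous_on ({0..S'} \<times> {0..1}) (\<lambda>(t, x). dx (\<gamma> i t) x)"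
      "continuous_on ({0..S'} \<times> {0..1}) (\<lambda>(t, x). dx (dx (\<gamma> i t)) x)"
      "continuous_on ({0..S'} \<times> {0..1}) (\<lambda>(t, x). V t x)"
    by (auto simp: parabolic_holder_def bounded_continuous_def Let_def V_def)
  have nz: "dx (\<gamma> i t) x \<noteq> 0" if "t \<in> {0..S'}" "x \<in> {0..1}" for t x
    using flow i that time unfolding curvature_flow_def by blast
  have "continuous_on ({0..S'} \<times> {0..1}) (\<lambda>(t, x). b t x)"
    unfolding b_def using cont(2-4) nz unfolding case_prod_unfold by (intro continuous_intros) auto
  then have "bounded ((\<lambda>(t, x). b t x) ` ({0..S'} \<times> {0..1}))"
    by (intro compact_imp_bounded compact_continuous_image compact_Times compact_Icc)
  then obtain B where B: "\<And>t x. t \<in> {0..S'} \<Longrightarrow> x \<in> {0..1} \<Longrightarrow> \<bar>b t x\<bar> \<le> B"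
    unfolding bounded_iff by force
  have ddx: "(dx (\<gamma> i t) has_vector_derivative dx (dx (\<gamma> i t)) x) (at x within {0..1})"
    if "t \<in> {0..S'}" "x \<in> {0..1}" for t x
    using diff(2)[OF that(1)] that(2) unfolding differentiable_on_def dx_def[of "dx (\<gamma> i t)"]
    by (simp add: vector_derivative_works)
  have dV: "((\<lambda>s. \<gamma> i s x) has_vector_derivative V t x) (at t within {0..S'})"
    if "t \<in> {0..S'}" "x \<in> {0..1}" for t x
    using diff(3)[OF that(2)] that(1) unfolding differentiable_on_def V_def dt_def
    by (simp add: vector_derivative_works)
  have "flow_curve S (\<gamma> i) V b B"
  proof
    fix t x :: real assume t: "t \<in> {0..S}" and x: "x \<in> {0..1}"
    then have t': "t \<in> {0..S'}" using sub by auto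
    show "(\<gamma> i t has_vector_derivative dx (\<gamma> i t) x) (at x within {0..1})"
      using diff(1)[OF t'] x unfolding differentiable_on_def dx_def[of "\<gamma> i t"]
      by (simp add: vector_derivative_works)
    show "(dx (\<gamma> i t) has_vector_derivative dx (dx (\<gamma> i t)) x) (at x within {0..1})"
      by (rule ddx[OF t' x])
    show "((\<lambda>s. \<gamma> i s x) has_vector_derivative V t x) (at t within {0..S})"
      by (rule has_vector_derivative_within_subset[OF dV[OF t' x] sub])
    show "dx (\<gamma> i t) x \<noteq> 0" by (rule nz[OF t' x])
    show "\<bar>b t x\<bar> \<le> B" by (rule B[OF t' x])
  next
    fix t x :: real assume t: "t \<in> {0<..S}" and x: "x \<in> {0..1}"
    then have t': "t \<in> {0..S'}" using sub by auto
    have ti: "t \<in> time_interval T" using t' time by auto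
    have "t \<in> interior {0..S'}" using t S by simp
    then have "at t within {0..S'} = at t" "at t within time_interval T = at t"
      using at_within_interior interior_mono[OF time] by blast+
    then have "V t x = dt (time_interval T) (\<gamma> i) t x" by (simp add: V_def dt_def)
    then have "normal_component (\<gamma> i t) x (V t x) = curvature_vector (\<gamma> i t) x"
      using flow i ti x unfolding curvature_flow_def by simp
    from velocity_from_normal_component[OF x nz[OF t' x] ddx[OF t' x] this]
    show "V t x = (1 / (norm (dx (\<gamma> i t) x))\<^sup>2) *\<^sub>R dx (dx (\<gamma> i t)) x + b t x *\<^sub>R dx (\<gamma> i t) x"
      by (simp add: b_def)
  next
    show "continuous_on ({0..S} \<times> {0..1}) (\<lambda>(t, x). \<gamma> i t x)"
      "continuous_on ({0..S} \<times> {0..1}) (\<lambda>(t, x). dx (\<gamma> i t) x)"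
      using cont(1,2) sub by (auto elim!: continuous_on_subset)
  qed (use S in auto)
  then show ?thesis by blast
qed

text \<open>Each time of the flow lies in a compact interval ending before \<open>T\<close>. A
  second time between \<open>S\<close> and \<open>T\<close> supplies the margin for
  \<open>curvature_flow_edge\<close>, and the edge data are chosen for all edges
  simultaneously.\<close>

lemma curvature_flow_network_flow:
  assumes "open \<Omega>" "convex \<Omega>" "regular_network \<Omega> n \<sigma>" and flow: "curvature_flow \<Omega> n \<sigma> \<alpha> T \<gamma>"
    and t: "t \<in> time_interval T"
  obtains S V b B where "t \<in> {0..S}" "network_flow \<Omega> n \<sigma> S \<gamma> V b B"
proof -
  have T: "max 0 (ereal t) < T" using flow t by (auto simp: curvature_flow_def time_interval_def)
  obtain S where S: "max 0 (ereal t) < ereal S" "ereal S < T"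
    using ereal_dense2[OF T] by blast
  obtain S' where S': "ereal S < ereal S'" "ereal S' < T"
    using ereal_dense2[OF S(2)] by blast
  have S0: "0 < S" "t < S" "S < S'" using S(1) S'(1) by auto
  have time: "s \<in> time_interval T" if "s \<in> {0..S}" for s
  proof -
    have "ereal s < T" by (rule le_less_trans[OF _ S(2)]) (use that in simp)
    then show ?thesis using that by (simp add: time_interval_def)
  qed
  have "\<forall>i\<in>{..<n}. \<exists>F. case F of (V, b, B) \<Rightarrow> flow_curve S (\<gamma> i) V b B"
    using curvature_flow_edge[OF flow _ S0(1,3) S'(2)] by simp
  from bchoice[OF this] obtain F
    where "\<forall>i\<in>{..<n}. case F i of (V, b, B) \<Rightarrow> flow_curve S (\<gamma> i) V b B" ..
  then have F: "\<And>i. i < n \<Longrightarrow> case F i of (V, b, B) \<Rightarrow> flow_curve S (\<gamma> i) V b B" by simp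
  have "network_flow \<Omega> n \<sigma> S \<gamma> (\<lambda>i. fst (F i)) (\<lambda>i. fst (snd (F i))) (\<lambda>i. snd (snd (F i)))"
  proof (rule network_flow.intro)
    show "flow_curve S (\<gamma> i) (fst (F i)) (fst (snd (F i))) (snd (snd (F i)))" if "i < n" for i
      using F[OF that] by (simp add: case_prod_unfold)
    show "\<gamma> i 0 x = \<sigma> i x" if "i < n" "x \<in> {0..1}" for i x
      using flow that by (simp add: curvature_flow_def)
    show "\<gamma> i s x = \<gamma> j s y"
      if "s \<in> {0..S}" "p \<in> multi_points n \<sigma>" "(i, x) \<in> ends_at n \<sigma> p" "(j, y) \<in> ends_at n \<sigma> p" for s p i x j y
      using flow time[OF that(1)] that(2-4) unfolding curvature_flow_def by fast
    show "(\<Sum>e\<in>ends_at n \<sigma> p. outward_tangent (\<lambda>i. \<gamma> i s) e) = 0"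
      if "s \<in> {0..S}" "p \<in> multi_points n \<sigma>" for s p
      using flow time[OF that(1)] that(2) unfolding curvature_flow_def by blast
    show "\<gamma> i s x = p" if "s \<in> {0..S}" "p \<in> end_points n \<sigma>" "(i, x) \<in> ends_at n \<sigma> p" for s p i x
      using flow time[OF that(1)] that(2,3) unfolding curvature_flow_def by fast
  qed (use assms S0 in auto)
  moreover have "t \<in> {0..S}" using t S0 by (auto simp: time_interval_def)
  ultimately show thesis using that by blast
qed

theorem proposition3p12:
  fixes \<Omega> :: "plane set" and n :: nat and \<sigma> :: "nat \<Rightarrow> real \<Rightarrow> plane"
    and \<alpha> :: real and T :: ereal and \<gamma> :: "nat \<Rightarrow> real \<Rightarrow> real \<Rightarrow> plane"
  assumes "open \<Omega>" and "bounded \<Omega>" and "convex \<Omega>" and "smooth_boundary \<Omega>"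
    and "regular_network \<Omega> n \<sigma>"
    and "curvature_flow \<Omega> n \<sigma> \<alpha> T \<gamma>"
  shows "(\<forall>t\<in>time_interval T.
            network_set n (\<lambda>i. \<gamma> i t) \<inter> frontier \<Omega> \<subseteq> end_points n (\<lambda>i. \<gamma> i t)) \<and>
         (\<forall>t\<in>time_interval T. 0 < t \<longrightarrow>
            (\<forall>i<n. \<forall>x\<in>{0..1}. \<gamma> i t x \<in> frontier \<Omega> \<longrightarrow>
               transversal_at (\<gamma> i t) x (frontier \<Omega>))) \<and>
         (\<forall>t\<in>time_interval T. embedded n (\<lambda>i. \<gamma> i t))"
proof (intro conjI ballI impI allI)
  fix t assume t: "t \<in> time_interval T"
  obtain S V b B where tS: "t \<in> {0..S}" and "network_flow \<Omega> n \<sigma> S \<gamma> V b B"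
    using curvature_flow_network_flow[OF assms(1,3,5,6) t] .
  then interpret network_flow \<Omega> n \<sigma> S \<gamma> V b B by simp
  show "network_set n (\<lambda>i. \<gamma> i t) \<inter> frontier \<Omega> \<subseteq> end_points n (\<lambda>i. \<gamma> i t)"
    by (rule meets_frontier_at_end_points[OF tS])
  show "embedded n (\<lambda>i. \<gamma> i t)" by (rule stays_embedded[OF tS])
  show "transversal_at (\<gamma> i t) x (frontier \<Omega>)"
    if "0 < t" "i < n" "x \<in> {0..1}" "\<gamma> i t x \<in> frontier \<Omega>" for i x
    by (rule transversal[OF assms(4) _ that(2-4)]) (use that(1) tS in auto)
qed

end
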